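(* Let $(W,S)$ be a finite Coxeter group with $S=\{s_1,\dots,s_n\}$, let $\Phi$ be a $W$-gluing data for abelian categories $(\mathcal{C}_w)_{w\in W}$, and let $M$ be a simple object of the glued category $\mathcal{C}(\Phi)$. Then either $\mathrm{Supp}(M)=W$ or $\mathrm{Supp}(M)$ is an intersection of subsets of the form $P_ix$ (with $i\in\{1,\dots,n\}$, $x\in W$). In particular, if $\mathrm{Supp}(M)\ne W$, then $\mathrm{Supp}(M)$ is convex.
   Context: A $W$-gluing data $\Phi$ consists of right-exact functors $\Phi_w:\mathcal{C}_{w'}\to\mathcal{C}_{ww'}$ for all $w,w'\in W$ (same symbol for all $w'$), with $\Phi_1=\mathrm{Id}$, and morphisms of functors $\nu_{w,w'}:\Phi_w\Phi_{w'}\to\Phi_{ww'}$ (on each $\mathcal{C}_{w''}$) with $\nu_{1,w}=\nu_{w,1}=\mathrm{id}$, satisfying associativity $\nu_{ww',w''}\circ(\nu_{w,w'}\Phi_{w''})=\nu_{w,w'w''}\circ(\Phi_w\nu_{w',w''})$, and such that $\nu_{w,w'}$ is an isomorphism whenever $\ell(ww')=\ell(w)+\ell(w')$. $\mathcal{C}(\Phi)$ is the abelian category of collections $(A_w,w\in W;\alpha_{w,w'})$ with $A_w\in\mathcal{C}_w$ and morphisms $\alpha_{w,w'}:\Phi_wA_{w'}\to A_{ww'}$, with $\alpha_{1,w'}=\mathrm{id}$ and $\alpha_{w_1,w_2w'}\circ\Phi_{w_1}(\alpha_{w_2,w'})=\alpha_{w_1w_2,w'}\circ\nu_{w_1,w_2}$;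 morphisms are componentwise and compatible with $\alpha$. $\mathrm{Supp}(A)=\{w\in W: A_w\neq0\}$. $P_i=\{w\in W:\ell(ws_i)=\ell(w)+1\}$. Consider the graph with vertex set $W$ and edges between $w$ and $sw$ for all $w\in W$, $s\in S$; geodesics are shortest paths in this graph. A subset $P\subset W$ is convex if every geodesic between vertices of $P$ lies entirely in $P$. *)

theory Defs
  imports "HOL-Algebra.Multiplicative_Group" "Graph_Theory.Vertex_Walk"
begin

section \<open>Coxeter groups\<close>

definition word_value :: "('w, 'b) monoid_scheme \<Rightarrow> 'w list \<Rightarrow> 'w" where
  "word_value W us = foldr (\<lambda>a b. a \<otimes>\<^bsub>W\<^esub> b) us \<one>\<^bsub>W\<^esub>"

text \<open>
  One insertion of a defining relator (s t)^m(s,t), where m(s,t) is the order of s t in W.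
  For s = t this is the relator s s.  If s t has infinite order then \<^const>\<open>group.ord\<close> is 0 and
  there is no relator.
\<close>

inductive relator_insertion :: "('w, 'b) monoid_scheme \<Rightarrow> 'w set \<Rightarrow> 'w list \<Rightarrow> 'w list \<Rightarrow> bool"
  for W S where
  "\<lbrakk>s \<in> S; t \<in> S\<rbrakk> \<Longrightarrow> relator_insertion W S (us @ vs)
      (us @ concat (replicate (group.ord W (s \<otimes>\<^bsub>W\<^esub> t)) [s, t]) @ vs)"

text \<open>
  The axiom \<open>presentation\<close> says that W is presented by the generators S and the relators above.
  Words without formal inverses suffice, because every generator is its own inverse modulo
  the relators s s.
\<close>

locale coxeter_system = group W for W (structure) +
  fixes S
  assumes gens_closed: "S \<subseteq> carrier W"
    and generates: "generate W S = carrier W"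
    and involutions: "s \<in> S \<Longrightarrow> s \<noteq> \<one> \<and> s \<otimes> s = \<one>"
    and presentation:
      "\<lbrakk>us \<in> lists S; word_value W us = \<one>\<rbrakk> \<Longrightarrow> equivclp (relator_insertion W S) us []"

definition coxeter_length :: "('w, 'b) monoid_scheme \<Rightarrow> 'w set \<Rightarrow> 'w \<Rightarrow> nat" where
  "coxeter_length W S w = (LEAST k. \<exists>us \<in> lists S. length us = k \<and> word_value W us = w)"

definition ascent_set :: "('w, 'b) monoid_scheme \<Rightarrow> 'w set \<Rightarrow> 'w \<Rightarrow> 'w set" where
  "ascent_set W S s =
    {w \<in> carrier W. coxeter_length W S (w \<otimes>\<^bsub>W\<^esub> s) = coxeter_length W S w + 1}"

text \<open>
  The undirected graph with edges between w and s w, as a digraph.  It is symmetric when the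
  elements of S are involutions.
\<close>

definition coxeter_graph :: "('w, 'b) monoid_scheme \<Rightarrow> 'w set \<Rightarrow> ('w, 'w \<times> 'w) pre_digraph" where
  "coxeter_graph W S =
    \<lparr>verts = carrier W, arcs = {(w, s \<otimes>\<^bsub>W\<^esub> w) | w s. w \<in> carrier W \<and> s \<in> S},
     tail = fst, head = snd\<rparr>"

definition geodesic :: "('v, 'e) pre_digraph \<Rightarrow> 'v list \<Rightarrow> bool" where
  "geodesic G p \<longleftrightarrow> vwalk p G \<and>
    (\<forall>q. vwalk q G \<and> hd q = hd p \<and> last q = last p \<longrightarrow> vwalk_length p \<le> vwalk_length q)"

definition geodesically_convex :: "('v, 'e) pre_digraph \<Rightarrow> 'v set \<Rightarrow> bool" where
  "geodesically_convex G P \<longleftrightarrow> P \<subseteq> verts G \<and>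
    (\<forall>p. geodesic G p \<and> hd p \<in> P \<and> last p \<in> P \<longrightarrow> set p \<subseteq> P)"


section \<open>Abelian categories\<close>

record ('o, 'm) category =
  Ob :: "'o set"
  Ar :: "'m set"
  dm :: "'m \<Rightarrow> 'o"
  cd :: "'m \<Rightarrow> 'o"
  ident :: "'o \<Rightarrow> 'm" ("\<i>\<index>")
  comp :: "'m \<Rightarrow> 'm \<Rightarrow> 'm" (infixl "\<cdot>\<index>" 70)

record ('o, 'm) preadditive_category = "('o, 'm) category" +
  plus_ar :: "'m \<Rightarrow> 'm \<Rightarrow> 'm" (infixl "\<boxplus>\<index>" 65)
  zero_ar :: "'o \<Rightarrow> 'o \<Rightarrow> 'm"

definition homset :: "('o, 'm, 'z) category_scheme \<Rightarrow> 'o \<Rightarrow> 'o \<Rightarrow> 'm set" where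
  "homset C A B = {f \<in> Ar C. dm C f = A \<and> cd C f = B}"

locale category =
  fixes C :: "('o, 'm, 'z) category_scheme" (structure)
  assumes dm_closed: "f \<in> Ar C \<Longrightarrow> dm C f \<in> Ob C"
    and cd_closed: "f \<in> Ar C \<Longrightarrow> cd C f \<in> Ob C"
    and ident_closed: "A \<in> Ob C \<Longrightarrow> \<i> A \<in> homset C A A"
    and comp_closed: "\<lbrakk>f \<in> homset C A B; g \<in> homset C B D\<rbrakk> \<Longrightarrow> g \<cdot> f \<in> homset C A D"
    and ident_right: "f \<in> homset C A B \<Longrightarrow> f \<cdot> \<i> A = f"
    and ident_left: "f \<in> homset C A B \<Longrightarrow> \<i> B \<cdot> f = f"
    and comp_assoc: "\<lbrakk>f \<in> homset C A B; g \<in> homset C B D; h \<in> homset C D E\<rbrakk>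
      \<Longrightarrow> h \<cdot> g \<cdot> f = h \<cdot> (g \<cdot> f)"

definition monic :: "('o, 'm, 'z) category_scheme \<Rightarrow> 'm \<Rightarrow> bool" where
  "monic C f \<longleftrightarrow> f \<in> Ar C \<and>
    (\<forall>T. \<forall>g \<in> homset C T (dm C f). \<forall>h \<in> homset C T (dm C f). f \<cdot>\<^bsub>C\<^esub> g = f \<cdot>\<^bsub>C\<^esub> h \<longrightarrow> g = h)"

definition epic :: "('o, 'm, 'z) category_scheme \<Rightarrow> 'm \<Rightarrow> bool" where
  "epic C f \<longleftrightarrow> f \<in> Ar C \<and>
    (\<forall>T. \<forall>g \<in> homset C (cd C f) T. \<forall>h \<in> homset C (cd C f) T. g \<cdot>\<^bsub>C\<^esub> f = h \<cdot>\<^bsub>C\<^esub> f \<longrightarrow> g = h)"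

definition iso_ar :: "('o, 'm, 'z) category_scheme \<Rightarrow> 'm \<Rightarrow> bool" where
  "iso_ar C f \<longleftrightarrow> f \<in> Ar C \<and>
    (\<exists>g \<in> homset C (cd C f) (dm C f). g \<cdot>\<^bsub>C\<^esub> f = \<i>\<^bsub>C\<^esub> (dm C f) \<and> f \<cdot>\<^bsub>C\<^esub> g = \<i>\<^bsub>C\<^esub> (cd C f))"

definition zero_object :: "('o, 'm, 'z) category_scheme \<Rightarrow> 'o \<Rightarrow> bool" where
  "zero_object C Z \<longleftrightarrow> Z \<in> Ob C \<and>
    (\<forall>A \<in> Ob C. (\<exists>!f. f \<in> homset C Z A) \<and> (\<exists>!f. f \<in> homset C A Z))"

definition simple_object :: "('o, 'm, 'z) category_scheme \<Rightarrow> 'o \<Rightarrow> bool" where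
  "simple_object C M \<longleftrightarrow> M \<in> Ob C \<and> \<not> zero_object C M \<and>
    (\<forall>f. monic C f \<and> cd C f = M \<longrightarrow> zero_object C (dm C f) \<or> iso_ar C f)"

definition hom_group :: "('o, 'm, 'z) preadditive_category_scheme \<Rightarrow> 'o \<Rightarrow> 'o \<Rightarrow> 'm monoid" where
  "hom_group C A B = \<lparr>carrier = homset C A B, monoid.mult = (\<lambda>f g. f \<boxplus>\<^bsub>C\<^esub> g), one = zero_ar C A B\<rparr>"

definition is_kernel :: "('o, 'm, 'z) preadditive_category_scheme \<Rightarrow> 'm \<Rightarrow> 'm \<Rightarrow> bool" where
  "is_kernel C f k \<longleftrightarrow> f \<in> Ar C \<and> k \<in> Ar C \<and> cd C k = dm C f \<and>
    f \<cdot>\<^bsub>C\<^esub> k = zero_ar C (dm C k) (cd C f) \<and>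
    (\<forall>T. \<forall>h \<in> homset C T (dm C f). f \<cdot>\<^bsub>C\<^esub> h = zero_ar C T (cd C f) \<longrightarrow>
      (\<exists>!u. u \<in> homset C T (dm C k) \<and> k \<cdot>\<^bsub>C\<^esub> u = h))"

definition is_cokernel :: "('o, 'm, 'z) preadditive_category_scheme \<Rightarrow> 'm \<Rightarrow> 'm \<Rightarrow> bool" where
  "is_cokernel C f c \<longleftrightarrow> f \<in> Ar C \<and> c \<in> Ar C \<and> dm C c = cd C f \<and>
    c \<cdot>\<^bsub>C\<^esub> f = zero_ar C (dm C f) (cd C c) \<and>
    (\<forall>T. \<forall>h \<in> homset C (cd C f) T. h \<cdot>\<^bsub>C\<^esub> f = zero_ar C (dm C f) T \<longrightarrow>
      (\<exists>!u. u \<in> homset C (cd C c) T \<and> u \<cdot>\<^bsub>C\<^esub> c = h))"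

locale preadditive_category = category C
  for C :: "('o, 'm, 'z) preadditive_category_scheme" (structure) +
  assumes hom_comm_group: "\<lbrakk>A \<in> Ob C; B \<in> Ob C\<rbrakk> \<Longrightarrow> comm_group (hom_group C A B)"
    and comp_plus_left: "\<lbrakk>f \<in> homset C A B; g \<in> homset C B D; h \<in> homset C B D\<rbrakk>
      \<Longrightarrow> (g \<boxplus> h) \<cdot> f = (g \<cdot> f) \<boxplus> (h \<cdot> f)"
    and comp_plus_right: "\<lbrakk>f \<in> homset C A B; g \<in> homset C A B; h \<in> homset C B D\<rbrakk>
      \<Longrightarrow> h \<cdot> (f \<boxplus> g) = (h \<cdot> f) \<boxplus> (h \<cdot> g)"

locale abelian_category = preadditive_category +
  assumes zero_exists: "\<exists>Z. zero_object C Z"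
    and biproduct_exists: "\<lbrakk>A \<in> Ob C; B \<in> Ob C\<rbrakk> \<Longrightarrow>
      \<exists>P. \<exists>i \<in> homset C A P. \<exists>j \<in> homset C B P. \<exists>p \<in> homset C P A. \<exists>q \<in> homset C P B.
        p \<cdot> i = \<i> A \<and> q \<cdot> j = \<i> B \<and> q \<cdot> i = zero_ar C A B \<and> p \<cdot> j = zero_ar C B A \<and>
        (i \<cdot> p) \<boxplus> (j \<cdot> q) = \<i> P"
    and kernel_exists: "f \<in> Ar C \<Longrightarrow> \<exists>k. is_kernel C f k"
    and cokernel_exists: "f \<in> Ar C \<Longrightarrow> \<exists>c. is_cokernel C f c"
    and monic_is_kernel: "monic C k \<Longrightarrow> \<exists>f. is_kernel C f k"
    and epic_is_cokernel: "epic C c \<Longrightarrow> \<exists>f. is_cokernel C f c"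

record ('o, 'm, 'p, 'n) cat_functor =
  on_ob :: "'o \<Rightarrow> 'p"
  on_ar :: "'m \<Rightarrow> 'n"

locale cat_functor = source: category C + target: category D
  for C :: "('o, 'm, 'z) category_scheme" and D :: "('p, 'n, 'y) category_scheme" +
  fixes F :: "('o, 'm, 'p, 'n) cat_functor"
  assumes on_ob_closed: "A \<in> Ob C \<Longrightarrow> on_ob F A \<in> Ob D"
    and on_ar_closed: "f \<in> homset C A B \<Longrightarrow> on_ar F f \<in> homset D (on_ob F A) (on_ob F B)"
    and on_ar_ident: "A \<in> Ob C \<Longrightarrow> on_ar F (\<i>\<^bsub>C\<^esub> A) = \<i>\<^bsub>D\<^esub> (on_ob F A)"
    and on_ar_comp: "\<lbrakk>f \<in> homset C A B; g \<in> homset C B E\<rbrakk>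
      \<Longrightarrow> on_ar F (g \<cdot>\<^bsub>C\<^esub> f) = on_ar F g \<cdot>\<^bsub>D\<^esub> on_ar F f"

text \<open>
  A sequence A -> B -> E -> 0 in an abelian category is exact iff its second arrow is a
  cokernel of the first, so \<open>preserves_cokernels\<close> is preservation of such exact sequences.
\<close>

locale right_exact_functor = cat_functor C D F
  for C :: "('o, 'm, 'z) preadditive_category_scheme"
    and D :: "('p, 'n, 'y) preadditive_category_scheme" and F +
  assumes additive: "\<lbrakk>f \<in> homset C A B; g \<in> homset C A B\<rbrakk>
      \<Longrightarrow> on_ar F (f \<boxplus>\<^bsub>C\<^esub> g) = on_ar F f \<boxplus>\<^bsub>D\<^esub> on_ar F g"
    and preserves_cokernels: "is_cokernel C f c \<Longrightarrow> is_cokernel D (on_ar F f) (on_ar F c)"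


section \<open>Gluing\<close>

text \<open>
  \<open>\<Phi> w w'\<close> is the functor \<open>\<Phi>\<^sub>w\<close> on \<open>C w'\<close>, and \<open>\<nu> w w' w'' A\<close> is the component at the object A
  of \<open>C w''\<close> of the transformation \<open>\<nu>\<^bsub>w,w'\<^esub>\<close>.
\<close>

locale gluing_data = coxeter_system W S
  for W :: "('w, 'b) monoid_scheme" (structure) and S +
  fixes C :: "'w \<Rightarrow> ('o, 'm, 'z) preadditive_category_scheme"
    and \<Phi> :: "'w \<Rightarrow> 'w \<Rightarrow> ('o, 'm, 'o, 'm) cat_functor"
    and \<nu> :: "'w \<Rightarrow> 'w \<Rightarrow> 'w \<Rightarrow> 'o \<Rightarrow> 'm"
  assumes abelian: "w \<in> carrier W \<Longrightarrow> abelian_category (C w)"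
    and right_exact: "\<lbrakk>w \<in> carrier W; w' \<in> carrier W\<rbrakk>
      \<Longrightarrow> right_exact_functor (C w') (C (w \<otimes> w')) (\<Phi> w w')"
    and one_on_ob: "\<lbrakk>w \<in> carrier W; A \<in> Ob (C w)\<rbrakk> \<Longrightarrow> on_ob (\<Phi> \<one> w) A = A"
    and one_on_ar: "\<lbrakk>w \<in> carrier W; f \<in> Ar (C w)\<rbrakk> \<Longrightarrow> on_ar (\<Phi> \<one> w) f = f"
    and nu_closed: "\<lbrakk>w \<in> carrier W; w' \<in> carrier W; w'' \<in> carrier W; A \<in> Ob (C w'')\<rbrakk>
      \<Longrightarrow> \<nu> w w' w'' A \<in> homset (C (w \<otimes> w' \<otimes> w''))
            (on_ob (\<Phi> w (w' \<otimes> w'')) (on_ob (\<Phi> w' w'') A)) (on_ob (\<Phi> (w \<otimes> w') w'') A)"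
    and nu_natural: "\<lbrakk>w \<in> carrier W; w' \<in> carrier W; w'' \<in> carrier W; f \<in> homset (C w'') A B\<rbrakk>
      \<Longrightarrow> \<nu> w w' w'' B \<cdot>\<^bsub>C (w \<otimes> w' \<otimes> w'')\<^esub> on_ar (\<Phi> w (w' \<otimes> w'')) (on_ar (\<Phi> w' w'') f) =
          on_ar (\<Phi> (w \<otimes> w') w'') f \<cdot>\<^bsub>C (w \<otimes> w' \<otimes> w'')\<^esub> \<nu> w w' w'' A"
    and nu_one_left: "\<lbrakk>w \<in> carrier W; w' \<in> carrier W; A \<in> Ob (C w')\<rbrakk>
      \<Longrightarrow> \<nu> \<one> w w' A = \<i>\<^bsub>C (w \<otimes> w')\<^esub> (on_ob (\<Phi> w w') A)"
    and nu_one_right: "\<lbrakk>w \<in> carrier W; w' \<in> carrier W; A \<in> Ob (C w')\<rbrakk>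
      \<Longrightarrow> \<nu> w \<one> w' A = \<i>\<^bsub>C (w \<otimes> w')\<^esub> (on_ob (\<Phi> w w') A)"
    and nu_assoc: "\<lbrakk>w \<in> carrier W; w' \<in> carrier W; w'' \<in> carrier W; x \<in> carrier W; A \<in> Ob (C x)\<rbrakk>
      \<Longrightarrow> \<nu> (w \<otimes> w') w'' x A \<cdot>\<^bsub>C (w \<otimes> w' \<otimes> w'' \<otimes> x)\<^esub> \<nu> w w' (w'' \<otimes> x) (on_ob (\<Phi> w'' x) A) =
          \<nu> w (w' \<otimes> w'') x A \<cdot>\<^bsub>C (w \<otimes> w' \<otimes> w'' \<otimes> x)\<^esub>
            on_ar (\<Phi> w (w' \<otimes> w'' \<otimes> x)) (\<nu> w' w'' x A)"
    and nu_iso: "\<lbrakk>w \<in> carrier W; w' \<in> carrier W; w'' \<in> carrier W; A \<in> Ob (C w'');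
        coxeter_length W S (w \<otimes> w') = coxeter_length W S w + coxeter_length W S w'\<rbrakk>
      \<Longrightarrow> iso_ar (C (w \<otimes> w' \<otimes> w'')) (\<nu> w w' w'' A)"

text \<open>
  Objects are pairs \<open>(A, \<alpha>)\<close>, with \<open>\<alpha> w w' : \<Phi>\<^sub>w (A w') \<rightarrow> A (w w')\<close>.  Arrows carry their source
  and target.  All families are extensional, so that equality of objects and arrows is
  equality of the families indexed by W.
\<close>

type_synonym ('w, 'o, 'm) glued_ob = "('w \<Rightarrow> 'o) \<times> ('w \<Rightarrow> 'w \<Rightarrow> 'm)"
type_synonym ('w, 'o, 'm) glued_ar =
  "('w, 'o, 'm) glued_ob \<times> ('w, 'o, 'm) glued_ob \<times> ('w \<Rightarrow> 'm)"

definition glued_objects ::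
  "('w, 'b) monoid_scheme \<Rightarrow> ('w \<Rightarrow> ('o, 'm, 'z) preadditive_category_scheme)
    \<Rightarrow> ('w \<Rightarrow> 'w \<Rightarrow> ('o, 'm, 'o, 'm) cat_functor) \<Rightarrow> ('w \<Rightarrow> 'w \<Rightarrow> 'w \<Rightarrow> 'o \<Rightarrow> 'm)
    \<Rightarrow> ('w, 'o, 'm) glued_ob set" where
  "glued_objects W C \<Phi> \<nu> = {(A, \<alpha>).
    A \<in> (\<Pi>\<^sub>E w \<in> carrier W. Ob (C w)) \<and>
    \<alpha> \<in> (\<Pi>\<^sub>E w \<in> carrier W. \<Pi>\<^sub>E w' \<in> carrier W.
      homset (C (w \<otimes>\<^bsub>W\<^esub> w')) (on_ob (\<Phi> w w') (A w')) (A (w \<otimes>\<^bsub>W\<^esub> w'))) \<and>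
    (\<forall>w' \<in> carrier W. \<alpha> \<one>\<^bsub>W\<^esub> w' = \<i>\<^bsub>C w'\<^esub> (A w')) \<and>
    (\<forall>w\<^sub>1 \<in> carrier W. \<forall>w\<^sub>2 \<in> carrier W. \<forall>w' \<in> carrier W.
      \<alpha> w\<^sub>1 (w\<^sub>2 \<otimes>\<^bsub>W\<^esub> w') \<cdot>\<^bsub>C (w\<^sub>1 \<otimes>\<^bsub>W\<^esub> w\<^sub>2 \<otimes>\<^bsub>W\<^esub> w')\<^esub> on_ar (\<Phi> w\<^sub>1 (w\<^sub>2 \<otimes>\<^bsub>W\<^esub> w')) (\<alpha> w\<^sub>2 w') =
      \<alpha> (w\<^sub>1 \<otimes>\<^bsub>W\<^esub> w\<^sub>2) w' \<cdot>\<^bsub>C (w\<^sub>1 \<otimes>\<^bsub>W\<^esub> w\<^sub>2 \<otimes>\<^bsub>W\<^esub> w')\<^esub> \<nu> w\<^sub>1 w\<^sub>2 w' (A w'))}"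

definition glued_arrows ::
  "('w, 'b) monoid_scheme \<Rightarrow> ('w \<Rightarrow> ('o, 'm, 'z) preadditive_category_scheme)
    \<Rightarrow> ('w \<Rightarrow> 'w \<Rightarrow> ('o, 'm, 'o, 'm) cat_functor) \<Rightarrow> ('w \<Rightarrow> 'w \<Rightarrow> 'w \<Rightarrow> 'o \<Rightarrow> 'm)
    \<Rightarrow> ('w, 'o, 'm) glued_ar set" where
  "glued_arrows W C \<Phi> \<nu> = {((A, \<alpha>), (B, \<beta>), f).
    (A, \<alpha>) \<in> glued_objects W C \<Phi> \<nu> \<and> (B, \<beta>) \<in> glued_objects W C \<Phi> \<nu> \<and>
    f \<in> (\<Pi>\<^sub>E w \<in> carrier W. homset (C w) (A w) (B w)) \<and>
    (\<forall>w \<in> carrier W. \<forall>w' \<in> carrier W.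
      f (w \<otimes>\<^bsub>W\<^esub> w') \<cdot>\<^bsub>C (w \<otimes>\<^bsub>W\<^esub> w')\<^esub> \<alpha> w w' =
      \<beta> w w' \<cdot>\<^bsub>C (w \<otimes>\<^bsub>W\<^esub> w')\<^esub> on_ar (\<Phi> w w') (f w'))}"

definition glued_category ::
  "('w, 'b) monoid_scheme \<Rightarrow> ('w \<Rightarrow> ('o, 'm, 'z) preadditive_category_scheme)
    \<Rightarrow> ('w \<Rightarrow> 'w \<Rightarrow> ('o, 'm, 'o, 'm) cat_functor) \<Rightarrow> ('w \<Rightarrow> 'w \<Rightarrow> 'w \<Rightarrow> 'o \<Rightarrow> 'm)
    \<Rightarrow> (('w, 'o, 'm) glued_ob, ('w, 'o, 'm) glued_ar) preadditive_category" where
  "glued_category W C \<Phi> \<nu> =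
    \<lparr>Ob = glued_objects W C \<Phi> \<nu>,
     Ar = glued_arrows W C \<Phi> \<nu>,
     dm = (\<lambda>(T, U, f). T),
     cd = (\<lambda>(T, U, f). U),
     ident = (\<lambda>T. (T, T, \<lambda>w \<in> carrier W. \<i>\<^bsub>C w\<^esub> (fst T w))),
     comp = (\<lambda>(U, V, g) (T, U', f). (T, V, \<lambda>w \<in> carrier W. g w \<cdot>\<^bsub>C w\<^esub> f w)),
     plus_ar = (\<lambda>(T, U, f) (T', U', g). (T, U, \<lambda>w \<in> carrier W. f w \<boxplus>\<^bsub>C w\<^esub> g w)),
     zero_ar = (\<lambda>T U. (T, U, \<lambda>w \<in> carrier W. zero_ar (C w) (fst T w) (fst U w)))\<rparr>"

definition glued_support ::
  "('w, 'b) monoid_scheme \<Rightarrow> ('w \<Rightarrow> ('o, 'm, 'z) preadditive_category_scheme)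
    \<Rightarrow> ('w, 'o, 'm) glued_ob \<Rightarrow> 'w set" where
  "glued_support W C M = {w \<in> carrier W. \<not> zero_object (C w) (fst M w)}"

end

theory Submission
  imports Defs
begin

text \<open>
Suppose that \<open>M\<close> is simple with a nonzero component \<open>M w\<close>.  The images of the structure maps
\<open>\<Phi>\<^bsub>v w\<inverse>\<^esub>(M w) \<rightarrow> M v\<close> form a nonzero subobject of \<open>M\<close>, so by simplicity all these maps are
epimorphisms (\<open>simple_structure_epic\<close>).  Now let \<open>s w\<close> be a neighbour of \<open>w\<close> outside the
support, and let \<open>v\<close> be on the same side of the wall between \<open>w\<close> and \<open>s w\<close> as \<open>s w\<close>.  Then
\<open>v w\<inverse> = u s\<close> with lengths adding up, so the structure map from \<open>w\<close> to \<open>v\<close> is, up to the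
isomorphism \<open>\<nu>\<close>, a map through \<open>\<Phi>\<^sub>u(M (s w)) = 0\<close>.  Being both zero and epic, it forces
\<open>M v = 0\<close>.  Thus the support lies in the halfspace \<open>P\<^sub>s w\<close> of every edge through which the
graph leaves the support (\<open>simple_support_in_boundary_halfspace\<close>).

The rest is combinatorics.  A reduced walk from the support to a point outside leaves the support
along some edge, and the halfspace of this edge contains the support but not the end point
(\<open>halfspace_separates_from_boundary_closed_set\<close>).  Hence a support that is not all of \<open>W\<close> is
the intersection of the halfspaces containing it.  Halfspaces are convex by folding walks in the
wall (\<open>halfspace_convex\<close>).  The facts about walls come from one invariant: the parity with which
a word crosses the wall of \<open>t\<close> depends only on the value of the word, since each defining relator
crosses every wall an even number of times (\<open>even_wall_crossings_unique\<close>).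
\<close>

section \<open>Walls and halfspaces of Coxeter groups\<close>

lemma word_value_Nil [simp]: "word_value G [] = \<one>\<^bsub>G\<^esub>"
  and word_value_Cons [simp]: "word_value G (a # us) = a \<otimes>\<^bsub>G\<^esub> word_value G us"
  by (simp_all add: word_value_def)

text \<open>
A word describes a path in the graph with edges between \<open>v\<close> and \<open>a v\<close>, starting at the unit
element; since the head of a word acts last, the path visits the values of the suffixes.
The edge from \<open>v\<close> to \<open>a v\<close> lies on the wall of the reflection \<open>v\<inverse> a v\<close>, and it is counted
here exactly if this reflection is \<open>t\<close>.  The equation \<open>a v = v t\<close> says the same without inverses.
\<close>

primrec wall_crossings :: "('w, 'b) monoid_scheme \<Rightarrow> 'w list \<Rightarrow> 'w \<Rightarrow> nat" where
  "wall_crossings G [] t = 0"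
| "wall_crossings G (a # us) t =
    of_bool (a \<otimes>\<^bsub>G\<^esub> word_value G us = word_value G us \<otimes>\<^bsub>G\<^esub> t) + wall_crossings G us t"

context group
begin

lemma word_value_closed [simp]: "us \<in> lists (carrier G) \<Longrightarrow> word_value G us \<in> carrier G"
  by (induction us) auto

lemma word_value_append:
  "\<lbrakk>us \<in> lists (carrier G); vs \<in> lists (carrier G)\<rbrakk>
    \<Longrightarrow> word_value G (us @ vs) = word_value G us \<otimes> word_value G vs"
  by (induction us) (auto simp: m_assoc)

lemma word_value_replicate_pair:
  assumes "s \<in> carrier G" "t \<in> carrier G"
  shows "word_value G (concat (replicate k [s, t])) = (s \<otimes> t) [^] k"
proof (induction k)
  case (Suc k)
  then show ?case
    using assms nat_pow_Suc2[of "s \<otimes> t" k] by (simp add: m_assoc del: nat_pow_Suc)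
qed simp

text \<open>
Right translation by the value of \<open>vs\<close> takes the path of \<open>us\<close> to the second part of the
path of \<open>us @ vs\<close>, and it conjugates the reflection of each edge.
\<close>

lemma wall_crossings_append:
  assumes "us \<in> lists (carrier G)" "vs \<in> lists (carrier G)" "t \<in> carrier G"
  shows "wall_crossings G (us @ vs) t =
    wall_crossings G us (word_value G vs \<otimes> t \<otimes> inv (word_value G vs)) + wall_crossings G vs t"
  using assms(1)
proof (induction us rule: list.induct)
  case (Cons a us)
  define u v where "u = word_value G us" and "v = word_value G vs"
  have uv: "u \<in> carrier G" "v \<in> carrier G" "a \<in> carrier G"
    using Cons.prems assms by (auto simp: u_def v_def)
  have "a \<otimes> (u \<otimes> v) = (u \<otimes> v) \<otimes> t \<longleftrightarrow> a \<otimes> u = u \<otimes> (v \<otimes> t \<otimes> inv v)"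
  proof -
    have "a \<otimes> (u \<otimes> v) = (a \<otimes> u) \<otimes> v" "(u \<otimes> v) \<otimes> t = u \<otimes> (v \<otimes> t \<otimes> inv v) \<otimes> v"
      using uv assms(3) by (simp_all add: m_assoc)
    then show ?thesis
      using uv assms(3) by simp
  qed
  then show ?case
    using Cons assms by (simp add: word_value_append u_def v_def)
qed simp

text \<open>
Weak form of the exchange condition: at an edge from \<open>v\<close> to \<open>a v = v t\<close>, deleting the letter
\<open>a\<close> multiplies the value of the whole word by \<open>t\<close> on the right.
\<close>

lemma wall_crossings_delete:
  assumes "us \<in> lists (carrier G)" "t \<in> carrier G" "wall_crossings G us t \<noteq> 0"
  shows "\<exists>vs \<in> lists (set us). length vs + 1 = length us \<and>
    word_value G vs \<otimes> t = word_value G us"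
  using assms
proof (induction us rule: list.induct)
  case (Cons a us)
  show ?case
  proof (cases "a \<otimes> word_value G us = word_value G us \<otimes> t")
    case True
    then show ?thesis by (intro bexI[of _ us]) auto
  next
    case False
    then obtain vs where "vs \<in> lists (set us)" "length vs + 1 = length us"
      "word_value G vs \<otimes> t = word_value G us"
      using Cons by auto
    moreover have "vs \<in> lists (carrier G)"
      using \<open>vs \<in> lists (set us)\<close> Cons.prems by auto
    ultimately show ?thesis
      using Cons.prems by (intro bexI[of _ "a # vs"]) (auto simp: m_assoc)
  qed
qed simp

text \<open>
The edges along \<open>(s t)\<^sup>k\<close> lie on the walls of \<open>t, t c, t c\<^sup>2, \<dots>\<close> with \<open>c = s t\<close>, because
\<open>t\<close> conjugates \<open>c\<close> to its inverse.  When \<open>c\<^sup>k\<close> is trivial this sequence has period \<open>k\<close>,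
so a defining relator crosses every wall an even number of times.
\<close>

lemma wall_crossings_dihedral:
  assumes st: "s \<in> carrier G" "t \<in> carrier G" "s \<otimes> s = \<one>" "t \<otimes> t = \<one>" and r: "r \<in> carrier G"
  shows "wall_crossings G (concat (replicate k [s, t])) r =
    (\<Sum>i<2 * k. of_bool (t \<otimes> (s \<otimes> t) [^] i = r))"
proof (induction k)
  case (Suc k)
  define c where "c = s \<otimes> t"
  have c: "c \<in> carrier G" using st by (simp add: c_def)
  have tct: "c \<otimes> t \<otimes> c = t"
    using st by (simp add: c_def m_assoc) (metis l_one m_assoc)
  have swap: "c [^] i \<otimes> (t \<otimes> c [^] i) = t" for i :: nat
  proof (induction i)
    case (Suc i)
    have "c [^] Suc i \<otimes> (t \<otimes> c [^] Suc i) = (c [^] i \<otimes> c) \<otimes> (t \<otimes> (c \<otimes> c [^] i))"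
      using nat_pow_Suc2[OF c, of i] by simp
    also have "\<dots> = c [^] i \<otimes> (c \<otimes> t \<otimes> c) \<otimes> c [^] i"
      using c st by (simp add: m_assoc)
    finally have "c [^] Suc i \<otimes> (t \<otimes> c [^] Suc i) = c [^] i \<otimes> (c \<otimes> t \<otimes> c) \<otimes> c [^] i" .
    then show ?case
      using Suc c st by (simp add: tct m_assoc)
  qed (use st in simp)
  have 1: "t \<otimes> c [^] k = c [^] k \<otimes> r \<longleftrightarrow> t \<otimes> c [^] (2 * k) = r"
  proof -
    have "c [^] k \<otimes> (t \<otimes> c [^] (2 * k)) = t \<otimes> c [^] k"
      using swap[of k] c st by (simp add: mult_2 m_assoc flip: nat_pow_mult)
        (metis m_assoc m_closed nat_pow_closed)
    then show ?thesis
      using c st r by (metis Units_eq Units_l_cancel m_closed nat_pow_closed)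
  qed
  have 2: "s \<otimes> (t \<otimes> c [^] k) = t \<otimes> c [^] k \<otimes> r \<longleftrightarrow> t \<otimes> c [^] Suc (2 * k) = r"
  proof -
    have "t \<otimes> c [^] k \<otimes> (t \<otimes> c [^] Suc (2 * k)) = t \<otimes> (c [^] k \<otimes> (t \<otimes> c [^] k)) \<otimes> c [^] Suc k"
      using c st by (simp add: m_assoc mult_2 flip: nat_pow_mult)
    also have "\<dots> = c [^] Suc k"
      using swap[of k] c st by simp
    also have "\<dots> = s \<otimes> (t \<otimes> c [^] k)"
      unfolding nat_pow_Suc2[OF c] using c st by (simp add: c_def m_assoc)
    finally show ?thesis
      using c st r by (metis Units_eq Units_l_cancel m_closed nat_pow_closed)
  qed
  show ?case
    using Suc 1 2 st by (simp add: word_value_replicate_pair flip: c_def)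
qed simp

end

lemma even_sum_period_twice:
  fixes f :: "nat \<Rightarrow> nat"
  assumes "\<And>i. f (i + m) = f i"
  shows "even (\<Sum>i<2 * m. f i)"
proof -
  have "(\<Sum>i<2 * m. f i) = (\<Sum>i<m. f i) + (\<Sum>i<m. f (i + m))"
    using sum.atLeastLessThan_concat[of 0 m "m + m" f] sum.shift_bounds_nat_ivl[of f 0 m m]
    by (simp add: mult_2 lessThan_atLeast0)
  then show ?thesis
    by (simp add: assms)
qed

context coxeter_system
begin

lemma gen_closed: "s \<in> S \<Longrightarrow> s \<in> carrier W"
  using gens_closed by blast

lemma gen_sq: "s \<in> S \<Longrightarrow> s \<otimes> s = \<one>"
  using involutions by blast

lemma gen_cancel_left [simp]: "\<lbrakk>s \<in> S; x \<in> carrier W\<rbrakk> \<Longrightarrow> s \<otimes> (s \<otimes> x) = x"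
  by (metis gen_closed gen_sq l_one m_assoc)

lemma gen_cancel_right [simp]: "\<lbrakk>s \<in> S; x \<in> carrier W\<rbrakk> \<Longrightarrow> x \<otimes> s \<otimes> s = x"
  by (simp add: gen_closed gen_sq m_assoc)

lemma gen_inv: "s \<in> S \<Longrightarrow> inv s = s"
  by (simp add: gen_closed gen_sq inv_equality)

lemma words_closed: "us \<in> lists S \<Longrightarrow> us \<in> lists (carrier W)"
  using gens_closed by auto

lemma word_exists:
  assumes "w \<in> carrier W"
  shows "\<exists>us \<in> lists S. word_value W us = w"
proof -
  have "w \<in> generate W S" using assms generates by simp
  then show ?thesis
  proof induction
    case one
    show ?case by (intro bexI[of _ "[]"]) auto
  next
    case (incl h)
    then show ?case by (intro bexI[of _ "[h]"]) (auto simp: gen_closed)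
  next
    case (inv h)
    then show ?case by (intro bexI[of _ "[h]"]) (auto simp: gen_closed gen_inv)
  next
    case (eng g h)
    then obtain us vs where "us \<in> lists S" "word_value W us = g" "vs \<in> lists S" "word_value W vs = h"
      by blast
    then show ?case
      by (intro bexI[of _ "us @ vs"]) (auto simp: word_value_append words_closed)
  qed
qed

abbreviation len :: "'a \<Rightarrow> nat" where "len \<equiv> coxeter_length W S"

lemma reduced_word:
  assumes "w \<in> carrier W"
  obtains us where "us \<in> lists S" "length us = len w" "word_value W us = w"
proof -
  have "\<exists>k. \<exists>us \<in> lists S. length us = k \<and> word_value W us = w"
    using word_exists[OF assms] by blast
  then have "\<exists>us \<in> lists S. length us = len w \<and> word_value W us = w"
    unfolding coxeter_length_def by (rule LeastI_ex)
  then show thesis using that by blast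
qed

lemma length_le: "us \<in> lists S \<Longrightarrow> len (word_value W us) \<le> length us"
  unfolding coxeter_length_def by (rule Least_le) blast

lemma length_zero_iff: "w \<in> carrier W \<Longrightarrow> len w = 0 \<longleftrightarrow> w = \<one>"
  using length_le[of "[]"] by (metis word_value_Nil length_0_conv lists.Nil le_zero_eq reduced_word)

lemma length_gen: "s \<in> S \<Longrightarrow> len s = 1"
proof -
  assume s: "s \<in> S"
  then have "len s \<le> 1" using length_le[of "[s]"] by (simp add: gen_closed)
  moreover have "len s \<noteq> 0" using s involutions by (simp add: length_zero_iff gen_closed)
  ultimately show ?thesis by simp
qed

lemma length_mult_gen_le:
  assumes "s \<in> S" "w \<in> carrier W"
  shows "len (w \<otimes> s) \<le> len w + 1"
proof -
  obtain us where us: "us \<in> lists S" "length us = len w" "word_value W us = w"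
    using reduced_word[OF assms(2)] .
  then show ?thesis
    using length_le[of "us @ [s]"] assms by (simp add: word_value_append words_closed gen_closed)
qed

text \<open>
An inserted relator has trivial value, so it leaves the reflections of the other edges
unchanged and only contributes its own crossings, an even number.
\<close>

lemma wall_crossings_relator_insertion:
  assumes "relator_insertion W S us vs" "t \<in> carrier W"
  shows "us \<in> lists S \<longleftrightarrow> vs \<in> lists S"
    and "us \<in> lists S \<Longrightarrow> even (wall_crossings W us t) = even (wall_crossings W vs t)"
  using assms(1)
proof -
  obtain s s' xs ys where *: "s \<in> S" "s' \<in> S" "us = xs @ ys"
    "vs = xs @ concat (replicate (ord (s \<otimes> s')) [s, s']) @ ys"
    using assms(1) by (auto elim: relator_insertion.cases)
  define R where "R = concat (replicate (ord (s \<otimes> s')) [s, s'])"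
  have R: "R \<in> lists S" using *(1,2) by (auto simp: R_def split: if_splits)
  show "us \<in> lists S \<longleftrightarrow> vs \<in> lists S" using * R by (auto simp: R_def)
  assume "us \<in> lists S"
  then have xs: "xs \<in> lists (carrier W)" "ys \<in> lists (carrier W)" "R \<in> lists (carrier W)"
    using * R by (auto simp: gen_closed)
  have val: "word_value W R = \<one>"
    using * by (simp add: R_def word_value_replicate_pair gen_closed)
  define r where "r = word_value W ys \<otimes> t \<otimes> inv (word_value W ys)"
  have r: "r \<in> carrier W" using xs assms by (simp add: r_def)
  have "even (\<Sum>i<2 * ord (s \<otimes> s'). of_bool (s' \<otimes> (s \<otimes> s') [^] i = r) :: nat)"
    using * by (intro even_sum_period_twice) (simp add: gen_closed flip: nat_pow_mult)
  then have "even (wall_crossings W R r)"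
    unfolding R_def using * r by (subst wall_crossings_dihedral) (simp_all add: gen_closed gen_sq)
  moreover have "wall_crossings W vs t =
      wall_crossings W xs r + (wall_crossings W R r + wall_crossings W ys t)"
    using * xs assms(2) r val
    by (simp add: wall_crossings_append word_value_append r_def flip: R_def)
  ultimately show "even (wall_crossings W us t) = even (wall_crossings W vs t)"
    using * xs assms(2) by (simp add: wall_crossings_append r_def)
qed

lemma wall_crossings_relator_equiv:
  assumes "equivclp (relator_insertion W S) us vs" "us \<in> lists S" "t \<in> carrier W"
  shows "vs \<in> lists S \<and> even (wall_crossings W us t) = even (wall_crossings W vs t)"
  using assms(1)
proof (induction rule: equivclp_induct)
  case (step xs ys)
  then show ?case
    using wall_crossings_relator_insertion assms(3) by metis
qed (use assms in auto)

text \<open>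
Both words can be prefixed by the reverse of \<open>us\<close>; the results have trivial value and thus are
equivalent to the empty word, which crosses no wall.  The common prefix is then cancelled.
\<close>

lemma even_wall_crossings_unique:
  assumes us: "us \<in> lists S" and vs: "vs \<in> lists S"
    and eq: "word_value W us = word_value W vs" and t: "t \<in> carrier W"
  shows "even (wall_crossings W us t) = even (wall_crossings W vs t)"
proof -
  have rev_inv: "word_value W (rev xs @ xs) = \<one>" if "xs \<in> lists S" for xs
    using that
  proof (induction xs rule: list.induct)
    case (Cons a xs)
    then have "rev xs \<in> lists (carrier W)" "xs \<in> lists (carrier W)" "a \<in> carrier W"
      by (auto simp: gen_closed)
    then show ?case using Cons by (simp add: word_value_append m_assoc)
  qed simp
  have cl: "us \<in> lists (carrier W)" "vs \<in> lists (carrier W)" "rev us \<in> lists (carrier W)"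
    "rev us \<in> lists S"
    using us vs by (auto simp: gen_closed)
  define r where "r = word_value W vs \<otimes> t \<otimes> inv (word_value W vs)"
  have r: "r \<in> carrier W" using cl t by (simp add: r_def)
  have one: "word_value W (rev us @ vs) = \<one>" "word_value W (rev us @ us) = \<one>"
    using rev_inv[OF us] cl eq by (simp_all add: word_value_append)
  have "even (wall_crossings W (rev us @ xs) t)" if "xs = us \<or> xs = vs" for xs
    using wall_crossings_relator_equiv[OF presentation, of "rev us @ xs" t] that one us vs cl t by auto
  from this[of us] this[of vs] show ?thesis
    using cl t eq by (simp add: wall_crossings_append flip: r_def)
qed

text \<open>
The bridge from lengths to walls.  If the parity is odd, a reduced word has a letter on the
wall of \<open>s\<close>, and deleting it gives a shorter word for \<open>w s\<close>.  If it is even, the parity for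
\<open>w s\<close> is odd, so that \<open>w\<close> is shorter than \<open>w s\<close>.
\<close>

lemma ascent_set_iff_even_wall_crossings:
  assumes s: "s \<in> S" and us: "us \<in> lists S"
  shows "word_value W us \<in> ascent_set W S s \<longleftrightarrow> even (wall_crossings W us s)"
proof -
  have shorten: "len (w \<otimes> s) < len w"
    if "vs \<in> lists S" "word_value W vs = w" "odd (wall_crossings W vs s)" for vs w
  proof -
    have w: "w \<in> carrier W" using words_closed[OF that(1)] that(2) word_value_closed by blast
    obtain us where us: "us \<in> lists S" "length us = len w" "word_value W us = w"
      using reduced_word[OF w] .
    then have "odd (wall_crossings W us s)"
      using that even_wall_crossings_unique[of us vs s] s by (simp add: gen_closed)
    then obtain xs where xs: "xs \<in> lists (set us)" "length xs + 1 = length us"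
      "word_value W xs \<otimes> s = w"
      using wall_crossings_delete[of us s] us s words_closed gen_closed by (metis even_zero)
    then have "xs \<in> lists S" using us by auto
    moreover have "w \<otimes> s = word_value W xs"
      using gen_cancel_right[OF s, of "word_value W xs"] words_closed[OF \<open>xs \<in> lists S\<close>] xs(3)
      by simp
    ultimately show ?thesis
      using length_le[of xs] xs us by simp
  qed
  define w where "w = word_value W us"
  have w: "w \<in> carrier W" using us words_closed[OF us] by (simp add: w_def)
  show ?thesis
  proof (cases "even (wall_crossings W us s)")
    case True
    then have "odd (wall_crossings W (us @ [s]) s)"
      using us s by (simp add: wall_crossings_append words_closed gen_closed gen_sq gen_inv m_assoc)
    then have "len (w \<otimes> s \<otimes> s) < len (w \<otimes> s)"
      using us s by (intro shorten[of "us @ [s]"]) 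
        (auto simp: w_def word_value_append words_closed gen_closed)
    then have "len (w \<otimes> s) = len w + 1"
      using length_mult_gen_le[OF s w] w s by simp
    then show ?thesis using True w by (simp add: ascent_set_def w_def)
  next
    case False
    then show ?thesis
      using shorten[OF us refl] by (auto simp: ascent_set_def)
  qed
qed

lemma not_ascent_length:
  assumes "s \<in> S" "w \<in> carrier W" "w \<notin> ascent_set W S s"
  shows "len w = len (w \<otimes> s) + 1"
proof -
  obtain us where us: "us \<in> lists S" "word_value W us = w" using word_exists[OF assms(2)] by blast
  then have "odd (wall_crossings W us s)"
    using assms ascent_set_iff_even_wall_crossings by blast
  then have "even (wall_crossings W (us @ [s]) s)"
    using us assms by (simp add: wall_crossings_append words_closed gen_closed gen_sq gen_inv m_assoc)
  then have "w \<otimes> s \<in> ascent_set W S s"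
    using ascent_set_iff_even_wall_crossings[of s "us @ [s]"] us assms
    by (simp add: word_value_append words_closed gen_closed)
  then show ?thesis
    using assms by (simp add: ascent_set_def)
qed

text \<open>
The parity of crossings of the wall of \<open>s\<close> changes along an edge only if the edge lies on that
wall.  Hence an edge between the two halfspaces is flipped by right multiplication with \<open>s\<close>.
\<close>

lemma crossing_edge_is_reflected:
  assumes "s \<in> S" "a \<in> S" "w \<in> carrier W"
    and "w \<in> ascent_set W S s \<longleftrightarrow> a \<otimes> w \<notin> ascent_set W S s"
  shows "a \<otimes> w = w \<otimes> s"
proof -
  obtain us where us: "us \<in> lists S" "word_value W us = w" using word_exists[OF assms(3)] by blast
  then show ?thesis
    using assms ascent_set_iff_even_wall_crossings[of s us]
      ascent_set_iff_even_wall_crossings[of s "a # us"]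
    by (auto split: if_splits)
qed

lemma halfspace_iff:
  assumes "x \<in> carrier W" 
  shows "v \<in> ascent_set W S s #> x \<longleftrightarrow> v \<in> carrier W \<and> v \<otimes> inv x \<in> ascent_set W S s"
proof
  assume "v \<in> ascent_set W S s #> x"
  then show "v \<in> carrier W \<and> v \<otimes> inv x \<in> ascent_set W S s"
    using assms by (auto simp: r_coset_def m_assoc) (auto simp: ascent_set_def m_assoc)
next
  assume "v \<in> carrier W \<and> v \<otimes> inv x \<in> ascent_set W S s"
  then show "v \<in> ascent_set W S s #> x"
    using assms by (auto simp: r_coset_def m_assoc intro!: bexI[of _ "v \<otimes> inv x"])
qed

lemma vwalk_coxeter_graph:
  "vwalk p (coxeter_graph W S) \<longleftrightarrow>
    p \<noteq> [] \<and> set p \<subseteq> carrier W \<and> successively (\<lambda>v w. \<exists>a \<in> S. w = a \<otimes> v) p"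
proof -
  have arcs: "(v, w) \<in> arcs_ends (coxeter_graph W S) \<longleftrightarrow> v \<in> carrier W \<and> (\<exists>a \<in> S. w = a \<otimes> v)" for v w
    by (auto simp: arcs_ends_conv coxeter_graph_def)
  have "set p \<subseteq> carrier W \<Longrightarrow> set (vwalk_arcs p) \<subseteq> arcs_ends (coxeter_graph W S) \<longleftrightarrow>
      successively (\<lambda>v w. \<exists>a \<in> S. w = a \<otimes> v) p"
    by (induction p rule: vwalk_arcs.induct) (auto simp: arcs)
  then show ?thesis
    by (auto simp: vwalk_def coxeter_graph_def)
qed

text \<open>
A walk that leaves a halfspace and returns can be folded: reflecting the part outside in the
wall makes each of the two crossing edges degenerate, so the folded walk has the same ends and
is shorter by two steps.
\<close>

lemma halfspace_convex:
  assumes s: "s \<in> S" and x: "x \<in> carrier W"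
  shows "geodesically_convex (coxeter_graph W S) (ascent_set W S s #> x)"
  unfolding geodesically_convex_def
proof (intro conjI allI impI)
  define H where "H = ascent_set W S s #> x"
  show "ascent_set W S s #> x \<subseteq> verts (coxeter_graph W S)"
    using halfspace_iff[OF x] by (auto simp: coxeter_graph_def)
  fix p assume "geodesic (coxeter_graph W S) p \<and>
    hd p \<in> ascent_set W S s #> x \<and> last p \<in> ascent_set W S s #> x"
  then have geo: "geodesic (coxeter_graph W S) p" and ends: "hd p \<in> H" "last p \<in> H"
    by (simp_all add: H_def)
  define adj where "adj = (\<lambda>v w. \<exists>a \<in> S. w = a \<otimes> v)"
  \<comment> \<open>Right multiplication by this conjugate of \<open>s\<close> is the reflection in the wall of the halfspace.\<close>
  define \<rho> where "\<rho> v = v \<otimes> (inv x \<otimes> s \<otimes> x)" for v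
  have walk: "p \<noteq> []" "set p \<subseteq> carrier W" "successively adj p"
    using geo by (auto simp: geodesic_def vwalk_coxeter_graph adj_def)
  have sW: "s \<in> carrier W" using s gen_closed by blast
  have \<rho>_closed: "v \<in> carrier W \<Longrightarrow> \<rho> v \<in> carrier W" for v
    using sW x by (simp add: \<rho>_def)
  have \<rho>_adj: "adj v w \<Longrightarrow> v \<in> carrier W \<Longrightarrow> adj (\<rho> v) (\<rho> w)" for v w
    using sW x by (force simp: adj_def \<rho>_def m_assoc gen_closed)
  have cross: "w = \<rho> v \<and> v = \<rho> w" if vw: "v \<in> carrier W" "adj v w" "v \<in> H \<longleftrightarrow> w \<notin> H" for v w
  proof -
    obtain a where a: "a \<in> S" "w = a \<otimes> v" using vw by (auto simp: adj_def)
    have "a \<otimes> (v \<otimes> inv x) = v \<otimes> inv x \<otimes> s"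
      using a s vw x by (intro crossing_edge_is_reflected)
        (auto simp: H_def halfspace_iff m_assoc gen_closed)
    then have "a \<otimes> v = v \<otimes> inv x \<otimes> s \<otimes> x"
      using a vw x sW gen_closed by (metis inv_closed inv_solve_right m_assoc m_closed)
    then have w: "w = \<rho> v" using a vw x sW by (simp add: \<rho>_def m_assoc)
    moreover have "\<rho> (\<rho> v) = v" 
    proof -
      have "\<rho> (\<rho> v) = v \<otimes> inv x \<otimes> s \<otimes> (x \<otimes> inv x) \<otimes> s \<otimes> x"
        using vw x sW by (simp only: \<rho>_def m_assoc m_closed inv_closed)
      also have "\<dots> = v" using vw x s sW gen_cancel_right[OF s, of "v \<otimes> inv x"] by (simp add: m_assoc)
      finally show ?thesis .
    qed
    ultimately show ?thesis by simp
  qed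
  have "set p \<subseteq> H"
  proof (rule ccontr)
    assume out: "\<not> set p \<subseteq> H"
    \<comment> \<open>\<open>bs\<close> is the first excursion to the outside of the halfspace.\<close>
    define as rest where "as = takeWhile (\<lambda>v. v \<in> H) p" and "rest = dropWhile (\<lambda>v. v \<in> H) p"
    define bs cs where "bs = takeWhile (\<lambda>v. v \<notin> H) rest" and "cs = dropWhile (\<lambda>v. v \<notin> H) rest"
    have p: "p = as @ bs @ cs" by (simp add: as_def rest_def bs_def cs_def)
    have as: "as \<noteq> []" "last as \<in> H"
    proof -
      show "as \<noteq> []" using walk(1) ends(1) by (cases p) (auto simp: as_def)
      then have "last as \<in> set as" by simp
      then show "last as \<in> H" by (auto simp: as_def dest: set_takeWhileD)
    qed
    have rest: "rest \<noteq> []" "hd rest \<notin> H" "last rest \<in> H"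
    proof -
      show *: "rest \<noteq> []" using out by (auto simp: rest_def)
      then show "hd rest \<notin> H" unfolding rest_def by (rule hd_dropWhile)
      show "last rest \<in> H" using ends * p by (metis as_def last_appendR rest_def takeWhile_dropWhile_id)
    qed
    have cs: "cs \<noteq> []" "hd cs \<in> H"
    proof -
      show *: "cs \<noteq> []" using rest unfolding cs_def by (metis dropWhile_eq_Nil_conv last_in_set)
      show "hd cs \<in> H" using hd_dropWhile * unfolding cs_def by blast
    qed
    have bs: "bs \<noteq> []" "hd bs \<notin> H" "last bs \<notin> H"
    proof -
      show *: "bs \<noteq> []" using rest by (cases rest) (auto simp: bs_def)
      have "set bs \<inter> H = {}" by (auto simp: bs_def dest: set_takeWhileD)
      then show "hd bs \<notin> H" "last bs \<notin> H" using * hd_in_set last_in_set by blast+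
    qed
    have adjs: "successively adj as" "successively adj bs" "successively adj cs"
      "adj (last as) (hd bs)" "adj (last bs) (hd cs)"
      using walk(3) as bs cs by (auto simp: p successively_append_iff)
    have sub: "set as \<subseteq> carrier W" "set bs \<subseteq> carrier W" "set cs \<subseteq> carrier W"
      using walk(2) by (auto simp: p)
    then have in_carrier: "last as \<in> carrier W" "last bs \<in> carrier W"
      using as(1) bs(1) last_in_set by blast+
    have in_refl: "\<rho> (hd bs) = last as" "\<rho> (last bs) = hd cs"
      using cross[OF in_carrier(1) adjs(4)] cross[OF in_carrier(2) adjs(5)] as bs cs by metis+
    \<comment> \<open>The folded ends of \<open>bs\<close> are \<open>last as\<close> and \<open>hd cs\<close>, so these are not repeated.\<close>
    define q where "q = butlast as @ map \<rho> bs @ tl cs"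
    have "successively adj (map \<rho> bs)"
      unfolding successively_map by (rule successively_mono[OF adjs(2)]) (use \<rho>_adj sub(2) in auto)
    moreover have "successively adj (butlast as)" "butlast as \<noteq> [] \<Longrightarrow> adj (last (butlast as)) (last as)"
      using adjs(1) successively_append_iff[of adj "butlast as" "[last as]"] as(1) by auto
    moreover have "successively adj (tl cs)" "tl cs \<noteq> [] \<Longrightarrow> adj (hd cs) (hd (tl cs))"
      using adjs(3) cs(1) by (cases cs; auto simp: successively_Cons)+
    ultimately have "successively adj q"
      using bs(1) in_refl by (auto simp: q_def successively_append_iff hd_map last_map)
    moreover have "set (butlast as) \<subseteq> set as" "set (tl cs) \<subseteq> set cs"
      by (auto dest: in_set_butlastD, cases cs, auto)
    then have "set q \<subseteq> carrier W"
      using sub \<rho>_closed by (auto simp: q_def)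
    ultimately have "vwalk q (coxeter_graph W S)"
      using bs(1) by (simp add: vwalk_coxeter_graph adj_def q_def)
    moreover have "hd q = hd p"
      using as bs in_refl by (cases as rule: rev_cases) (auto simp: q_def p hd_append hd_map)
    moreover have "last q = last p"
      using bs cs in_refl by (cases cs) (auto simp: q_def p last_map)
    moreover have "length q + 2 = length p" "length q > 0"
      using as(1) cs(1) bs(1) by (cases as; cases bs; cases cs; simp add: q_def p)+
    moreover have "length p - 1 \<le> length q - 1" if "vwalk q (coxeter_graph W S)" "hd q = hd p" "last q = last p"
      using geo that by (simp add: geodesic_def)
    ultimately show False by linarith
  qed
  then show "set p \<subseteq> ascent_set W S s #> x" by (simp add: H_def)
qed

text \<open>
If \<open>P\<close> lies on the inner side of every edge that leaves \<open>P\<close>, walk from a point of \<open>P\<close> to \<open>y\<close>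
along a reduced word.  At the edge from \<open>w\<close> to \<open>s w\<close> where the walk leaves \<open>P\<close>, the
rest of the walk shows that \<open>s w\<close> is closer to \<open>y\<close> than \<open>w\<close>, so \<open>y\<close> is on the outer side
of this edge.
\<close>

lemma halfspace_separates_from_boundary_closed_set:
  assumes P: "P \<subseteq> carrier W" "P \<noteq> {}"
    and boundary: "\<And>w s. \<lbrakk>w \<in> P; s \<in> S; s \<otimes> w \<notin> P\<rbrakk> \<Longrightarrow> P \<subseteq> ascent_set W S s #> w"
    and y: "y \<in> carrier W" "y \<notin> P"
  shows "\<exists>s \<in> S. \<exists>x \<in> carrier W. P \<subseteq> ascent_set W S s #> x \<and> y \<notin> ascent_set W S s #> x"
proof -
  obtain w where "w \<in> P" using P by blast
  then show ?thesis
  proof (induction "len (y \<otimes> inv w)" arbitrary: w rule: less_induct)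
    case less
    then have w: "w \<in> carrier W" using P by blast
    obtain us where us: "us \<in> lists S" "length us = len (y \<otimes> inv w)" "word_value W us = y \<otimes> inv w"
      using reduced_word[of "y \<otimes> inv w"] y w by auto
    have "us \<noteq> []"
    proof
      assume "us = []"
      then have "y = w" using us(3) y w inv_solve_right[of \<one> y w] by simp
      then show False using less y by blast
    qed
    then obtain vs s where vs: "us = vs @ [s]" by (metis rev_exhaust)
    then have s: "s \<in> S" "s \<in> carrier W" and vs': "vs \<in> lists S" using us(1) gen_closed by auto
    have "word_value W vs \<otimes> s = y \<otimes> inv w"
      using us(3) vs vs' s by (simp add: word_value_append words_closed)
    then have val: "word_value W vs = y \<otimes> inv w \<otimes> s"
      using gen_cancel_right[OF s(1), of "word_value W vs"] words_closed[OF vs'] by simp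
    then have shorter: "len (y \<otimes> inv w \<otimes> s) < len (y \<otimes> inv w)"
      using length_le[OF vs'] us(2) vs by simp
    show ?case
    proof (cases "s \<otimes> w \<in> P")
      case True
      have "y \<otimes> inv (s \<otimes> w) = y \<otimes> inv w \<otimes> s"
        using y w s by (simp add: inv_mult_group gen_inv m_assoc)
      then show ?thesis using less True shorter by metis
    next
      case False
      have "y \<notin> ascent_set W S s #> w"
        using shorter halfspace_iff[OF w] by (auto simp: ascent_set_def)
      then show ?thesis using boundary[OF less(2) s(1) False] s(1) w by blast
    qed
  qed
qed

end

section \<open>Factorization and lifting in abelian categories\<close>

lemma homsetD:
  assumes "f \<in> homset C A B"
  shows "f \<in> Ar C" "dm C f = A" "cd C f = B"
  using assms by (auto simp: homset_def)

lemma monicD: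
  assumes "monic C m" "m \<in> homset C A B" "g \<in> homset C T A" "h \<in> homset C T A"
    "m \<cdot>\<^bsub>C\<^esub> g = m \<cdot>\<^bsub>C\<^esub> h"
  shows "g = h"
  using assms by (auto simp: monic_def homset_def)

lemma epicD:
  assumes "epic C e" "e \<in> homset C A B" "g \<in> homset C B T" "h \<in> homset C B T"
    "g \<cdot>\<^bsub>C\<^esub> e = h \<cdot>\<^bsub>C\<^esub> e"
  shows "g = h"
  using assms by (auto simp: epic_def homset_def)

lemma kernel_factors:
  assumes "is_kernel C f k" "f \<in> homset C A B" "h \<in> homset C T A" "f \<cdot>\<^bsub>C\<^esub> h = zero_ar C T B"
  obtains u where "u \<in> homset C T (dm C k)" "k \<cdot>\<^bsub>C\<^esub> u = h"
  using assms unfolding is_kernel_def homset_def by blast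

lemma cokernel_factors:
  assumes "is_cokernel C f c" "f \<in> homset C A B" "h \<in> homset C B T" "h \<cdot>\<^bsub>C\<^esub> f = zero_ar C A T"
  obtains u where "u \<in> homset C (cd C c) T" "u \<cdot>\<^bsub>C\<^esub> c = h"
  using assms unfolding is_cokernel_def homset_def by blast

context category
begin

lemma monic_comp:
  assumes "monic C k" "k \<in> homset C A B" "monic C m" "m \<in> homset C B D"
  shows "monic C (m \<cdot> k)"
proof -
  have mk: "m \<cdot> k \<in> homset C A D" using assms comp_closed by blast
  have "g = h" if gh: "g \<in> homset C T A" "h \<in> homset C T A" "m \<cdot> k \<cdot> g = m \<cdot> k \<cdot> h" for T g h
  proof -
    have "k \<cdot> g = k \<cdot> h"
      using monicD[OF assms(3,4)] comp_assoc[OF _ assms(2,4)] comp_closed[OF _ assms(2)] gh by metis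
    then show ?thesis using monicD[OF assms(1,2)] gh by blast
  qed
  then show ?thesis using mk by (auto simp: monic_def homset_def)
qed

lemma epic_comp:
  assumes "epic C e" "e \<in> homset C A B" "epic C c" "c \<in> homset C B D"
  shows "epic C (c \<cdot> e)"
proof -
  have ce: "c \<cdot> e \<in> homset C A D" using assms comp_closed by blast
  have "g = h" if gh: "g \<in> homset C D T" "h \<in> homset C D T" "g \<cdot> (c \<cdot> e) = h \<cdot> (c \<cdot> e)" for T g h
  proof -
    have "g \<cdot> c = h \<cdot> c"
      using epicD[OF assms(1,2)] comp_assoc[OF assms(2,4)] comp_closed[OF assms(4)] gh by metis
    then show ?thesis using epicD[OF assms(3,4)] gh by blast
  qed
  then show ?thesis using ce by (auto simp: epic_def homset_def)
qed

lemma iso_epic: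
  assumes "iso_ar C f"
  shows "epic C f"
proof -
  define A B where "A = dm C f" and "B = cd C f"
  obtain g where f: "f \<in> homset C A B" and g: "g \<in> homset C B A" "f \<cdot> g = \<i> B"
    using assms by (auto simp: iso_ar_def homset_def A_def B_def)
  have "u = v" if "u \<in> homset C B T" "v \<in> homset C B T" "u \<cdot> f = v \<cdot> f" for T u v
    using that comp_assoc[OF g(1) f] ident_right g(2) by metis
  then show ?thesis using f by (auto simp: epic_def homset_def)
qed

lemma homset_objects: "f \<in> homset C A B \<Longrightarrow> A \<in> Ob C \<and> B \<in> Ob C"
  using dm_closed cd_closed by (auto simp: homset_def)

end

context preadditive_category
begin

abbreviation zero where "zero \<equiv> zero_ar C"

lemma zero_closed: "A \<in> Ob C \<Longrightarrow> B \<in> Ob C \<Longrightarrow> zero A B \<in> homset C A B"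
proof -
  assume "A \<in> Ob C" "B \<in> Ob C"
  then interpret comm_group "hom_group C A B" by (rule hom_comm_group)
  show ?thesis using one_closed by (simp add: hom_group_def)
qed

lemma plus_zero: "f \<in> homset C A B \<Longrightarrow> f \<boxplus> zero A B = f"
proof -
  assume f: "f \<in> homset C A B"
  interpret comm_group "hom_group C A B" using f homset_objects hom_comm_group by blast
  show ?thesis using r_one[of f] f by (simp add: hom_group_def)
qed

lemma idempotent_is_zero:
  assumes "f \<in> homset C A B" "f \<boxplus> f = f"
  shows "f = zero A B"
proof -
  interpret comm_group "hom_group C A B" using assms homset_objects hom_comm_group by blast
  show ?thesis using l_cancel_one[of f f] assms by (simp add: hom_group_def)
qed

lemma comp_zero_right:
  assumes "g \<in> homset C A B" "T \<in> Ob C"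
  shows "g \<cdot> zero T A = zero T B"
proof -
  have T: "zero T A \<in> homset C T A" using assms homset_objects zero_closed by blast
  then have "(g \<cdot> zero T A) \<boxplus> (g \<cdot> zero T A) = g \<cdot> zero T A"
    using comp_plus_right[OF T T assms(1)] plus_zero[OF T] by simp
  then show ?thesis using idempotent_is_zero comp_closed T assms by blast
qed

lemma comp_zero_left:
  assumes "g \<in> homset C A B" "T \<in> Ob C"
  shows "zero B T \<cdot> g = zero A T"
proof -
  have T: "zero B T \<in> homset C B T" using assms homset_objects zero_closed by blast
  then have "(zero B T \<cdot> g) \<boxplus> (zero B T \<cdot> g) = zero B T \<cdot> g"
    using comp_plus_left[OF assms(1) T T] plus_zero[OF T] by simp
  then show ?thesis using idempotent_is_zero comp_closed T assms by blast
qed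

lemma zero_object_iff: "zero_object C A \<longleftrightarrow> A \<in> Ob C \<and> \<i> A = zero A A"
proof
  assume "zero_object C A"
  then show "A \<in> Ob C \<and> \<i> A = zero A A"
    unfolding zero_object_def using ident_closed zero_closed by blast
next
  assume A: "A \<in> Ob C \<and> \<i> A = zero A A"
  have "f = zero A B" if "f \<in> homset C A B" for f B
    using A that ident_right comp_zero_right by metis
  moreover have "f = zero B A" if "f \<in> homset C B A" for f B
    using A that ident_left comp_zero_left by metis
  ultimately show "zero_object C A"
    unfolding zero_object_def using A zero_closed by blast
qed

lemma zero_object_arrow_from:
  assumes "zero_object C A" "f \<in> homset C A B"
  shows "f = zero A B"
proof -
  have "f \<cdot> \<i> A = zero A B"
    using assms comp_zero_right[OF assms(2)] by (simp add: zero_object_iff)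
  then show ?thesis using ident_right[OF assms(2)] by simp
qed

lemma zero_object_arrow_to:
  assumes "zero_object C A" "f \<in> homset C B A"
  shows "f = zero B A"
proof -
  have "\<i> A \<cdot> f = zero B A"
    using assms comp_zero_left[OF assms(2)] by (simp add: zero_object_iff)
  then show ?thesis using ident_left[OF assms(2)] by simp
qed

lemma kernel_monic:
  assumes k: "is_kernel C f k"
  shows "monic C k"
proof -
  define K A B where "K = dm C k" and "A = dm C f" and "B = cd C f"
  have kh: "k \<in> homset C K A" and fh: "f \<in> homset C A B" and fk: "f \<cdot> k = zero K B"
    using k by (auto simp: is_kernel_def homset_def K_def A_def B_def)
  have "g = h" if gh: "g \<in> homset C T K" "h \<in> homset C T K" "k \<cdot> g = k \<cdot> h" for T g h
  proof -
    have "f \<cdot> (k \<cdot> h) = zero T B"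
      using comp_assoc[OF gh(2) kh fh] fk comp_zero_left[OF gh(2)] homset_objects[OF fh] by simp
    then have "\<exists>!u. u \<in> homset C T K \<and> k \<cdot> u = k \<cdot> h"
      using k comp_closed[OF gh(2) kh] by (auto simp: is_kernel_def K_def A_def B_def)
    then show ?thesis using gh by metis
  qed
  then show ?thesis using kh by (auto simp: monic_def homset_def)
qed

lemma cokernel_epic:
  assumes c: "is_cokernel C f c"
  shows "epic C c"
proof -
  define Q A B where "Q = cd C c" and "A = dm C f" and "B = cd C f"
  have ch: "c \<in> homset C B Q" and fh: "f \<in> homset C A B" and cf: "c \<cdot> f = zero A Q"
    using c by (auto simp: is_cokernel_def homset_def Q_def A_def B_def)
  have "g = h" if gh: "g \<in> homset C Q T" "h \<in> homset C Q T" "g \<cdot> c = h \<cdot> c" for T g h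
  proof -
    have "h \<cdot> c \<cdot> f = zero A T"
      using comp_assoc[OF fh ch gh(2)] cf comp_zero_right[OF gh(2)] homset_objects[OF fh] by simp
    then have "\<exists>!u. u \<in> homset C Q T \<and> u \<cdot> c = h \<cdot> c"
      using c comp_closed[OF ch gh(2)] by (auto simp: is_cokernel_def Q_def A_def B_def)
    then show ?thesis using gh by metis
  qed
  then show ?thesis using ch by (auto simp: epic_def homset_def)
qed

text \<open>
Homomorphisms can be subtracted, so cancellation need only be tested against zero.
\<close>

lemma epicI_zero:
  assumes e: "e \<in> homset C A B"
    and cancel: "\<And>T t. \<lbrakk>t \<in> homset C B T; t \<cdot> e = zero A T\<rbrakk> \<Longrightarrow> t = zero B T"
  shows "epic C e"
proof -
  have "g = h" if gh: "g \<in> homset C B T" "h \<in> homset C B T" "g \<cdot> e = h \<cdot> e" for T g h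
  proof -
    have obs: "A \<in> Ob C" "B \<in> Ob C" "T \<in> Ob C" using e gh homset_objects by blast+
    interpret BT: comm_group "hom_group C B T" using obs hom_comm_group by blast
    interpret AT: comm_group "hom_group C A T" using obs hom_comm_group by blast
    obtain h' where h': "h' \<in> homset C B T" "h \<boxplus> h' = zero B T" "h' \<boxplus> h = zero B T"
      using BT.inv_closed[of h] BT.r_inv[of h] BT.l_inv[of h] gh by (auto simp: hom_group_def)
    have "(g \<boxplus> h') \<cdot> e = (h \<boxplus> h') \<cdot> e"
      using comp_plus_left[OF e gh(1) h'(1)] comp_plus_left[OF e gh(2) h'(1)] gh(3) by simp
    then have "(g \<boxplus> h') \<cdot> e = zero A T"
      using h' comp_zero_left e obs by simp
    moreover have "g \<boxplus> h' \<in> homset C B T"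
      using BT.m_closed[of g h'] gh h' by (simp add: hom_group_def)
    ultimately have gh': "g \<boxplus> h' = zero B T" using cancel by blast
    show "g = h"
      using BT.right_cancel[of h' g h] gh' gh h' by (simp add: hom_group_def)
  qed
  then show ?thesis using e by (auto simp: epic_def homset_def)
qed

lemma epic_zero_arrow:
  assumes "epic C (zero A B)" "A \<in> Ob C" "B \<in> Ob C"
  shows "zero_object C B"
proof -
  have z: "zero A B \<in> homset C A B" "zero B B \<in> homset C B B" using assms zero_closed by blast+
  have "\<i> B \<cdot> zero A B = zero B B \<cdot> zero A B"
    using ident_left[OF z(1)] comp_zero_left[OF z(1) assms(3)] by simp
  then show ?thesis
    using epicD[OF assms(1) z(1) ident_closed[OF assms(3)] z(2)] assms(3) zero_object_iff by blast
qed

end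

context abelian_category
begin

text \<open>
The monomorphism is the kernel of some \<open>g\<close>, and \<open>g y\<close> vanishes because it does after
composition with the epimorphism.
\<close>

lemma epic_monic_lift:
  assumes e: "epic C e" "e \<in> homset C A B" and m: "monic C m" "m \<in> homset C D E"
    and x: "x \<in> homset C A D" and y: "y \<in> homset C B E" and square: "y \<cdot> e = m \<cdot> x"
  shows "\<exists>d \<in> homset C B D. m \<cdot> d = y"
proof -
  obtain g where g: "is_kernel C g m" using monic_is_kernel m(1) by blast
  define F where "F = cd C g"
  have g_hom: "g \<in> homset C E F" and gm: "g \<cdot> m = zero D F"
    using g m(2) by (auto simp: is_kernel_def homset_def F_def)
  have obs: "A \<in> Ob C" "B \<in> Ob C" "F \<in> Ob C" using homset_objects e(2) g_hom by blast+
  have "g \<cdot> y \<cdot> e = g \<cdot> m \<cdot> x"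
    using comp_assoc[OF e(2) y g_hom] comp_assoc[OF x m(2) g_hom] square by simp
  also have "\<dots> = zero B F \<cdot> e"
    using comp_zero_left[OF x obs(3)] comp_zero_left[OF e(2) obs(3)] gm by simp
  finally have "g \<cdot> y = zero B F"
    using epicD[OF e comp_closed[OF y g_hom] zero_closed[OF obs(2,3)]] by blast
  then show ?thesis
    using kernel_factors[OF g g_hom y] homsetD(2)[OF m(2)] by metis
qed

text \<open>
The image \<open>m\<close> is the kernel of the cokernel \<open>q\<close> of \<open>f\<close>.  If \<open>t e = 0\<close>, then \<open>f\<close> factors
through the smaller subobject \<open>m k\<close>, where \<open>k\<close> is the kernel of \<open>t\<close>.  This subobject is the
kernel of some \<open>g\<close>, which kills \<open>f\<close>, thus factors through \<open>q\<close>, and so kills \<open>m\<close>.  Therefore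
\<open>m\<close> factors through \<open>m k\<close>, \<open>k\<close> has a right inverse and \<open>t = 0\<close>.
\<close>

lemma epic_monic_factorization:
  assumes f: "f \<in> homset C A B"
  shows "\<exists>I. \<exists>e \<in> homset C A I. \<exists>m \<in> homset C I B. epic C e \<and> monic C m \<and> f = m \<cdot> e"
proof -
  obtain q where q: "is_cokernel C f q" using cokernel_exists homsetD(1)[OF f] by blast
  define Q where "Q = cd C q"
  have q_hom: "q \<in> homset C B Q" and qf: "q \<cdot> f = zero A Q"
    using q f by (auto simp: is_cokernel_def homset_def Q_def)
  obtain m where m: "is_kernel C q m" using kernel_exists homsetD(1)[OF q_hom] by blast
  define I where "I = dm C m"
  have m_hom: "m \<in> homset C I B" and qm: "q \<cdot> m = zero I Q"
    using m q_hom by (auto simp: is_kernel_def homset_def I_def)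
  have obs: "A \<in> Ob C" "B \<in> Ob C" "Q \<in> Ob C" "I \<in> Ob C"
    using homset_objects f q_hom m_hom by blast+
  obtain e where e: "e \<in> homset C A I" "m \<cdot> e = f"
    using kernel_factors[OF m q_hom f qf] I_def by blast
  have m_monic: "monic C m" using kernel_monic[OF m] .
  have "epic C e"
  proof (rule epicI_zero[OF e(1)])
    fix T t assume t: "t \<in> homset C I T" "t \<cdot> e = zero A T"
    obtain k where k: "is_kernel C t k" using kernel_exists homsetD(1)[OF t(1)] by blast
    define K where "K = dm C k"
    have k_hom: "k \<in> homset C K I" and tk: "t \<cdot> k = zero K T"
      using k t(1) by (auto simp: is_kernel_def homset_def K_def)
    obtain u where u: "u \<in> homset C A K" "k \<cdot> u = e"
      using kernel_factors[OF k t(1) e(1) t(2)] K_def by blast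
    have "monic C (m \<cdot> k)"
      using monic_comp[OF kernel_monic[OF k] k_hom m_monic m_hom] .
    then obtain g where g: "is_kernel C g (m \<cdot> k)" using monic_is_kernel by blast
    define G where "G = cd C g"
    have mk: "m \<cdot> k \<in> homset C K B" using comp_closed k_hom m_hom by blast
    have g_hom: "g \<in> homset C B G" and gmk: "g \<cdot> (m \<cdot> k) = zero K G"
      using g mk by (auto simp: is_kernel_def homset_def G_def)
    have G: "G \<in> Ob C" and K: "K \<in> Ob C" and T: "T \<in> Ob C"
      using homset_objects g_hom k_hom t(1) by blast+
    have "g \<cdot> f = g \<cdot> (m \<cdot> k) \<cdot> u"
      using comp_assoc[OF u(1) mk g_hom] comp_assoc[OF u(1) k_hom m_hom] e u by simp
    also have "\<dots> = zero A G" using gmk comp_zero_left[OF u(1) G] by simp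
    finally obtain g' where g': "g' \<in> homset C Q G" "g' \<cdot> q = g"
      using cokernel_factors[OF q f g_hom] Q_def by blast
    have "g \<cdot> m = zero I G"
      using comp_assoc[OF m_hom q_hom g'(1)] g'(2) qm comp_zero_right[OF g'(1) obs(4)] by simp
    then obtain r where r: "r \<in> homset C I K" "m \<cdot> k \<cdot> r = m"
      using kernel_factors[OF g g_hom m_hom] homsetD(2)[OF mk] by metis
    have "m \<cdot> (k \<cdot> r) = m \<cdot> \<i> I"
      using comp_assoc[OF r(1) k_hom m_hom] r(2) ident_right[OF m_hom] by simp
    then have "k \<cdot> r = \<i> I"
      using monicD[OF m_monic m_hom comp_closed[OF r(1) k_hom] ident_closed[OF obs(4)]] by blast
    then have "t = t \<cdot> k \<cdot> r"
      using comp_assoc[OF r(1) k_hom t(1)] ident_right[OF t(1)] by simp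
    then show "t = zero I T" using tk comp_zero_left[OF r(1) T] by simp
  qed
  then show ?thesis using e m_hom m_monic by blast
qed

end

context right_exact_functor
begin

lemma preserves_zero_arrow:
  assumes "preadditive_category C" "preadditive_category D" "A \<in> Ob C" "B \<in> Ob C"
  shows "on_ar F (zero_ar C A B) = zero_ar D (on_ob F A) (on_ob F B)"
proof -
  interpret C: preadditive_category C by fact
  interpret D: preadditive_category D by fact
  have z: "zero_ar C A B \<in> homset C A B" using C.zero_closed assms by blast
  show ?thesis
    using D.idempotent_is_zero[OF on_ar_closed[OF z]] additive[OF z z] C.plus_zero[OF z] by metis
qed

lemma preserves_epic:
  assumes "abelian_category C" "preadditive_category D" "epic C e"
  shows "epic D (on_ar F e)"
proof -
  obtain f where "is_cokernel C f e"
    using abelian_category.epic_is_cokernel[OF assms(1,3)] by blast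
  then show ?thesis
    using preadditive_category.cokernel_epic[OF assms(2)] preserves_cokernels by blast
qed

end

section \<open>Simple objects of the glued category\<close>

context gluing_data
begin

abbreviation glued where "glued \<equiv> glued_category W C \<Phi> \<nu>"
abbreviation objects where "objects \<equiv> glued_objects W C \<Phi> \<nu>"
abbreviation arrows where "arrows \<equiv> glued_arrows W C \<Phi> \<nu>"

lemma component_preadditive: "w \<in> carrier W \<Longrightarrow> preadditive_category (C w)"
  using abelian abelian_category.axioms(1) by blast

lemma component_category: "w \<in> carrier W \<Longrightarrow> category (C w)"
  using component_preadditive preadditive_category.axioms(1) by blast

lemma gluing_functor: "\<lbrakk>w \<in> carrier W; w' \<in> carrier W\<rbrakk> \<Longrightarrow> cat_functor (C w') (C (w \<otimes> w')) (\<Phi> w w')"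
  using right_exact right_exact_functor.axioms(1) by blast

lemma glued_objectsD:
  assumes "(A, \<alpha>) \<in> objects"
  shows object_component: "w \<in> carrier W \<Longrightarrow> A w \<in> Ob (C w)"
    and structure_component: "\<lbrakk>w \<in> carrier W; w' \<in> carrier W\<rbrakk>
      \<Longrightarrow> \<alpha> w w' \<in> homset (C (w \<otimes> w')) (on_ob (\<Phi> w w') (A w')) (A (w \<otimes> w'))"
    and structure_one: "w' \<in> carrier W \<Longrightarrow> \<alpha> \<one> w' = \<i>\<^bsub>C w'\<^esub> (A w')"
    and structure_assoc: "\<lbrakk>w\<^sub>1 \<in> carrier W; w\<^sub>2 \<in> carrier W; w' \<in> carrier W\<rbrakk> \<Longrightarrow>
      \<alpha> w\<^sub>1 (w\<^sub>2 \<otimes> w') \<cdot>\<^bsub>C (w\<^sub>1 \<otimes> w\<^sub>2 \<otimes> w')\<^esub> on_ar (\<Phi> w\<^sub>1 (w\<^sub>2 \<otimes> w')) (\<alpha> w\<^sub>2 w') =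
      \<alpha> (w\<^sub>1 \<otimes> w\<^sub>2) w' \<cdot>\<^bsub>C (w\<^sub>1 \<otimes> w\<^sub>2 \<otimes> w')\<^esub> \<nu> w\<^sub>1 w\<^sub>2 w' (A w')"
  using assms by (auto simp: glued_objects_def PiE_iff)

lemma glued_arrowsD:
  assumes "(N, M, f) \<in> arrows"
  shows "N \<in> objects" "M \<in> objects" "f \<in> extensional (carrier W)"
    and "w \<in> carrier W \<Longrightarrow> f w \<in> homset (C w) (fst N w) (fst M w)"
  using assms by (auto simp: glued_arrows_def PiE_iff)

lemma glued_homset: "F \<in> homset glued N M \<longleftrightarrow> (\<exists>f. F = (N, M, f) \<and> (N, M, f) \<in> arrows)"
  by (cases F) (auto simp: homset_def glued_category_def)

lemma identity_arrow:
  assumes "N \<in> objects"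
  shows "\<i>\<^bsub>glued\<^esub> N \<in> homset glued N N"
proof -
  obtain A \<alpha> where N: "N = (A, \<alpha>)" by force
  show ?thesis
    using assms unfolding N glued_homset
    by (auto simp: glued_category_def glued_arrows_def glued_objectsD
        cat_functor.on_ar_ident[OF gluing_functor] category.ident_closed[OF component_category]
        category.ident_left[OF component_category structure_component] category.ident_right[OF component_category structure_component])
qed

lemma zero_arrow:
  assumes "N \<in> objects" "M \<in> objects"
  shows "zero_ar glued N M \<in> homset glued N M"
proof -
  obtain A \<alpha> B \<beta> where NM: "N = (A, \<alpha>)" "M = (B, \<beta>)" by force
  show ?thesis
    using assms unfolding NM glued_homset
    by (auto simp: glued_category_def glued_arrows_def glued_objectsD
        right_exact_functor.preserves_zero_arrow[OF right_exact] component_preadditive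
        preadditive_category.zero_closed[OF component_preadditive]
        preadditive_category.comp_zero_left[OF component_preadditive structure_component]
        preadditive_category.comp_zero_right[OF component_preadditive structure_component]
        cat_functor.on_ob_closed[OF gluing_functor])
qed

text \<open>
An object is zero exactly if its identity is its zero endomorphism, and both are computed in
each component.
\<close>

lemma glued_zero_object_iff:
  assumes "N \<in> objects"
  shows "zero_object glued N \<longleftrightarrow> (\<forall>w \<in> carrier W. zero_object (C w) (fst N w))"
proof
  assume "zero_object glued N"
  then have "\<i>\<^bsub>glued\<^esub> N = zero_ar glued N N"
    using identity_arrow[OF assms] zero_arrow[OF assms assms] unfolding zero_object_def by blast
  then have "\<And>w. w \<in> carrier W \<Longrightarrow> \<i>\<^bsub>C w\<^esub> (fst N w) = zero_ar (C w) (fst N w) (fst N w)"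
    by (simp add: glued_category_def restrict_def fun_eq_iff) metis
  then show "\<forall>w \<in> carrier W. zero_object (C w) (fst N w)"
    using assms by (cases N) (simp add: preadditive_category.zero_object_iff[OF component_preadditive] object_component)
next
  assume zero: "\<forall>w \<in> carrier W. zero_object (C w) (fst N w)"
  have "F = zero_ar glued N M" if F: "F \<in> homset glued N M" for F M
  proof -
    obtain f where f: "F = (N, M, f)" "(N, M, f) \<in> arrows" using F glued_homset by blast
    have "f = (\<lambda>w \<in> carrier W. zero_ar (C w) (fst N w) (fst M w))"
      using glued_arrowsD[OF f(2)] zero preadditive_category.zero_object_arrow_from[OF component_preadditive]
      by (intro extensionalityI[of _ "carrier W"]) auto
    then show ?thesis using f by (simp add: glued_category_def)
  qed
  moreover have "F = zero_ar glued M N" if F: "F \<in> homset glued M N" for F M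
  proof -
    obtain f where f: "F = (M, N, f)" "(M, N, f) \<in> arrows" using F glued_homset by blast
    have "f = (\<lambda>w \<in> carrier W. zero_ar (C w) (fst M w) (fst N w))"
      using glued_arrowsD[OF f(2)] zero preadditive_category.zero_object_arrow_to[OF component_preadditive]
      by (intro extensionalityI[of _ "carrier W"]) auto
    then show ?thesis using f by (simp add: glued_category_def)
  qed
  moreover have "Ob glued = objects" by (simp add: glued_category_def)
  ultimately show "zero_object glued N"
    unfolding zero_object_def using assms zero_arrow by metis
qed

lemma glued_monicI:
  assumes f: "(N, M, f) \<in> arrows" and monic: "\<And>w. w \<in> carrier W \<Longrightarrow> monic (C w) (f w)"
  shows "monic glued (N, M, f)"
proof -
  have "g = h" if "(T, N, g) \<in> arrows" "(T, N, h) \<in> arrows"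
    and eq: "(\<lambda>w \<in> carrier W. f w \<cdot>\<^bsub>C w\<^esub> g w) = (\<lambda>w \<in> carrier W. f w \<cdot>\<^bsub>C w\<^esub> h w)" for T g h
  proof (rule extensionalityI)
    show "g \<in> extensional (carrier W)" "h \<in> extensional (carrier W)"
      using that glued_arrowsD by blast+
    fix w assume w: "w \<in> carrier W"
    then have "f w \<cdot>\<^bsub>C w\<^esub> g w = f w \<cdot>\<^bsub>C w\<^esub> h w" using fun_cong[OF eq, of w] by simp
    then show "g w = h w"
      using monicD[OF monic[OF w] glued_arrowsD(4)[OF f w] glued_arrowsD(4)[OF that(1) w]
          glued_arrowsD(4)[OF that(2) w]] by blast
  qed
  then show ?thesis
    using f by (auto simp: monic_def glued_homset) (auto simp: glued_category_def)
qed

lemma glued_iso_component: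
  assumes "iso_ar glued (N, M, f)" and w: "w \<in> carrier W"
  shows "iso_ar (C w) (f w)"
proof -
  have f: "(N, M, f) \<in> arrows"
    using assms(1) by (simp add: iso_ar_def glued_category_def)
  obtain g where g: "(M, N, g) \<in> arrows"
    and gf: "(\<lambda>w \<in> carrier W. g w \<cdot>\<^bsub>C w\<^esub> f w) = (\<lambda>w \<in> carrier W. \<i>\<^bsub>C w\<^esub> (fst N w))"
    and fg: "(\<lambda>w \<in> carrier W. f w \<cdot>\<^bsub>C w\<^esub> g w) = (\<lambda>w \<in> carrier W. \<i>\<^bsub>C w\<^esub> (fst M w))"
    using assms(1) by (auto simp: iso_ar_def glued_homset) (auto simp: glued_category_def)
  show ?thesis
    using glued_arrowsD(4)[OF f w] glued_arrowsD(4)[OF g w] fun_cong[OF gf, of w] fun_cong[OF fg, of w] w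
    unfolding iso_ar_def homset_def by auto
qed

text \<open>
The structure maps \<open>\<beta>\<close> of the subobject are the restrictions of \<open>\<alpha>\<close>.  Their unit and
associativity laws hold after composition with the monomorphisms \<open>m\<close>, where they become the
laws for \<open>\<alpha>\<close>.
\<close>

lemma subobject_of_stable_family:
  assumes M: "(A, \<alpha>) \<in> objects"
    and m: "\<And>w. w \<in> carrier W \<Longrightarrow> m w \<in> homset (C w) (I w) (A w)"
    and monic: "\<And>w. w \<in> carrier W \<Longrightarrow> monic (C w) (m w)"
    and stable: "\<And>x w. \<lbrakk>x \<in> carrier W; w \<in> carrier W\<rbrakk> \<Longrightarrow>
      \<exists>d \<in> homset (C (x \<otimes> w)) (on_ob (\<Phi> x w) (I w)) (I (x \<otimes> w)).
        m (x \<otimes> w) \<cdot>\<^bsub>C (x \<otimes> w)\<^esub> d = \<alpha> x w \<cdot>\<^bsub>C (x \<otimes> w)\<^esub> on_ar (\<Phi> x w) (m w)"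
  shows "\<exists>\<beta>. ((restrict I (carrier W), \<beta>), (A, \<alpha>), restrict m (carrier W)) \<in> arrows"
proof -
  obtain d where d: "\<And>x w. \<lbrakk>x \<in> carrier W; w \<in> carrier W\<rbrakk> \<Longrightarrow>
      d x w \<in> homset (C (x \<otimes> w)) (on_ob (\<Phi> x w) (I w)) (I (x \<otimes> w))"
    and md: "\<And>x w. \<lbrakk>x \<in> carrier W; w \<in> carrier W\<rbrakk> \<Longrightarrow>
      m (x \<otimes> w) \<cdot>\<^bsub>C (x \<otimes> w)\<^esub> d x w = \<alpha> x w \<cdot>\<^bsub>C (x \<otimes> w)\<^esub> on_ar (\<Phi> x w) (m w)"
    using stable by metis
  define \<beta> where "\<beta> = (\<lambda>x \<in> carrier W. \<lambda>w \<in> carrier W. d x w)"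
  have I: "I w \<in> Ob (C w)" if "w \<in> carrier W" for w
    using category.homset_objects[OF component_category[OF that] m[OF that]] by blast
  have d_one: "d \<one> w = \<i>\<^bsub>C w\<^esub> (I w)" if w: "w \<in> carrier W" for w
  proof -
    interpret category "C w" using component_category[OF w] .
    have dw: "d \<one> w \<in> homset (C w) (I w) (I w)"
      using d[of \<one> w] w one_on_ob[OF w I[OF w]] by simp
    have "m w \<cdot>\<^bsub>C w\<^esub> d \<one> w = m w \<cdot>\<^bsub>C w\<^esub> \<i>\<^bsub>C w\<^esub> (I w)"
      using md[of \<one> w] w one_on_ar[OF w homsetD(1)[OF m[OF w]]] structure_one[OF M w]
        ident_left[OF m[OF w]] ident_right[OF m[OF w]] by simp
    then show ?thesis
      using monicD[OF monic[OF w] m[OF w] dw ident_closed[OF I[OF w]]] by blast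
  qed
  have d_assoc: "d x (y \<otimes> w) \<cdot>\<^bsub>C (x \<otimes> y \<otimes> w)\<^esub> on_ar (\<Phi> x (y \<otimes> w)) (d y w) =
      d (x \<otimes> y) w \<cdot>\<^bsub>C (x \<otimes> y \<otimes> w)\<^esub> \<nu> x y w (I w)"
    if xyw: "x \<in> carrier W" "y \<in> carrier W" "w \<in> carrier W" for x y w
  proof -
    have yw: "y \<otimes> w \<in> carrier W" and xy: "x \<otimes> y \<in> carrier W" and z: "x \<otimes> y \<otimes> w \<in> carrier W"
      and assoc: "x \<otimes> (y \<otimes> w) = x \<otimes> y \<otimes> w"
      using xyw by (simp_all add: m_assoc)
    interpret Z: category "C (x \<otimes> y \<otimes> w)" using component_category[OF z] .
    interpret Fx: cat_functor "C (y \<otimes> w)" "C (x \<otimes> y \<otimes> w)" "\<Phi> x (y \<otimes> w)"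
      using gluing_functor[OF xyw(1) yw] assoc by simp
    interpret Fy: cat_functor "C w" "C (y \<otimes> w)" "\<Phi> y w" using gluing_functor[OF xyw(2,3)] .
    interpret Fxy: cat_functor "C w" "C (x \<otimes> y \<otimes> w)" "\<Phi> (x \<otimes> y) w" using gluing_functor[OF xy xyw(3)] .
    let ?c = "comp (C (x \<otimes> y \<otimes> w))" and ?Fx = "on_ar (\<Phi> x (y \<otimes> w))" and ?Fy = "on_ar (\<Phi> y w)"
    note m' = m[OF xyw(3)] m[OF yw] m[OF z]
    note d' = d[OF xyw(2,3)] d[OF xyw(1) yw, unfolded assoc] d[OF xy xyw(3)]
    note a' = structure_component[OF M xyw(2,3)] structure_component[OF M xyw(1) yw, unfolded assoc]
      structure_component[OF M xy xyw(3)]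
    note n' = nu_closed[OF xyw I[OF xyw(3)]] nu_closed[OF xyw object_component[OF M xyw(3)]]
    note Fd = Fx.on_ar_closed[OF d'(1)] and Fm = Fx.on_ar_closed[OF m'(2)]
      and Fa = Fx.on_ar_closed[OF a'(1)] and Fym = Fy.on_ar_closed[OF m'(1)]
      and FFm = Fx.on_ar_closed[OF Fy.on_ar_closed[OF m'(1)]] and Fxym = Fxy.on_ar_closed[OF m'(1)]
    have "?c (m (x \<otimes> y \<otimes> w)) (?c (d x (y \<otimes> w)) (?Fx (d y w))) =
        ?c (?c (\<alpha> x (y \<otimes> w)) (?Fx (m (y \<otimes> w)))) (?Fx (d y w))"
      using Z.comp_assoc[OF Fd d'(2) m'(3)] md[OF xyw(1) yw, unfolded assoc] by simp
    also have "\<dots> = ?c (\<alpha> x (y \<otimes> w)) (?Fx (m (y \<otimes> w) \<cdot>\<^bsub>C (y \<otimes> w)\<^esub> d y w))"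
      using Z.comp_assoc[OF Fd Fm a'(2)] Fx.on_ar_comp[OF d'(1) m'(2)] by simp
    also have "\<dots> = ?c (\<alpha> x (y \<otimes> w)) (?c (?Fx (\<alpha> y w)) (?Fx (?Fy (m w))))"
      using md[OF xyw(2,3)] Fx.on_ar_comp[OF Fym a'(1)] by simp
    also have "\<dots> = ?c (?c (\<alpha> (x \<otimes> y) w) (\<nu> x y w (A w))) (?Fx (?Fy (m w)))"
      using Z.comp_assoc[OF FFm Fa a'(2)] structure_assoc[OF M xyw] by simp
    also have "\<dots> = ?c (\<alpha> (x \<otimes> y) w) (?c (on_ar (\<Phi> (x \<otimes> y) w) (m w)) (\<nu> x y w (I w)))"
      using Z.comp_assoc[OF FFm n'(2) a'(3)] nu_natural[OF xyw m'(1)] by simp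
    also have "\<dots> = ?c (m (x \<otimes> y \<otimes> w)) (?c (d (x \<otimes> y) w) (\<nu> x y w (I w)))"
      using Z.comp_assoc[OF n'(1) Fxym a'(3)] Z.comp_assoc[OF n'(1) d'(3) m'(3)] md[OF xy xyw(3)]
      by simp
    finally show ?thesis
      using monicD[OF monic[OF z] m'(3) Z.comp_closed[OF Fd d'(2)] Z.comp_closed[OF n'(1) d'(3)]]
      by blast
  qed
  have "(restrict I (carrier W), \<beta>) \<in> objects"
    using I d d_one d_assoc by (auto simp: glued_objects_def \<beta>_def)
  then show ?thesis
    using M m md by (intro exI[of _ \<beta>]) (auto simp: glued_arrows_def \<beta>_def)
qed

text \<open>
The component at \<open>w\<close> generates a subobject of \<open>A\<close>: its component at \<open>v\<close> is the image of the
structure map from \<open>\<Phi>\<^bsub>v w\<inverse>\<^esub>(A w)\<close> to \<open>A v\<close>.  It is stable because a right exact functor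
takes the epimorphism onto an image to an epimorphism, and the structure maps compose.  At \<open>w\<close> it
is all of \<open>A w\<close>, so it is not zero and by simplicity it is everything.
\<close>

lemma simple_structure_epic:
  assumes simple: "simple_object glued (A, \<alpha>)"
    and u: "u \<in> carrier W" and w: "w \<in> carrier W" and nonzero: "\<not> zero_object (C w) (A w)"
  shows "epic (C (u \<otimes> w)) (\<alpha> u w)"
proof -
  have M: "(A, \<alpha>) \<in> objects" using simple by (simp add: simple_object_def glued_category_def)
  define r where "r v = v \<otimes> inv w" for v
  have r: "r v \<in> carrier W" "r v \<otimes> w = v" if "v \<in> carrier W" for v
    using that w by (simp_all add: r_def m_assoc)
  have a: "\<alpha> (r v) w \<in> homset (C v) (on_ob (\<Phi> (r v) w) (A w)) (A v)" if "v \<in> carrier W" for v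
    using structure_component[OF M r(1)[OF that] w] r(2)[OF that] by simp
  have "\<forall>v \<in> carrier W. \<exists>I e m. e \<in> homset (C v) (on_ob (\<Phi> (r v) w) (A w)) I \<and>
      m \<in> homset (C v) I (A v) \<and> epic (C v) e \<and> monic (C v) m \<and> \<alpha> (r v) w = m \<cdot>\<^bsub>C v\<^esub> e"
    using abelian_category.epic_monic_factorization[OF abelian a] by blast
  then obtain I e m where e: "\<And>v. v \<in> carrier W \<Longrightarrow> e v \<in> homset (C v) (on_ob (\<Phi> (r v) w) (A w)) (I v)"
    and m: "\<And>v. v \<in> carrier W \<Longrightarrow> m v \<in> homset (C v) (I v) (A v)"
    and epic: "\<And>v. v \<in> carrier W \<Longrightarrow> epic (C v) (e v)"
    and monic: "\<And>v. v \<in> carrier W \<Longrightarrow> monic (C v) (m v)"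
    and me: "\<And>v. v \<in> carrier W \<Longrightarrow> \<alpha> (r v) w = m v \<cdot>\<^bsub>C v\<^esub> e v"
    by metis
  \<comment> \<open>Stability of the images \<open>I\<close>: the square to be lifted has the image under
    \<open>\<Phi>\<^sub>x\<close> of \<open>e v\<close> on its left and \<open>m (x v)\<close> on its right.\<close>
  have "\<exists>d \<in> homset (C (x \<otimes> v)) (on_ob (\<Phi> x v) (I v)) (I (x \<otimes> v)).
      m (x \<otimes> v) \<cdot>\<^bsub>C (x \<otimes> v)\<^esub> d = \<alpha> x v \<cdot>\<^bsub>C (x \<otimes> v)\<^esub> on_ar (\<Phi> x v) (m v)"
    if x: "x \<in> carrier W" and v: "v \<in> carrier W" for x v
  proof -
    have xv: "x \<otimes> v \<in> carrier W" and rr: "r (x \<otimes> v) = x \<otimes> r v" and rx: "x \<otimes> r v \<otimes> w = x \<otimes> v"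
      using x v w by (simp_all add: r_def m_assoc)
    interpret Z: abelian_category "C (x \<otimes> v)" using abelian[OF xv] .
    interpret F: right_exact_functor "C v" "C (x \<otimes> v)" "\<Phi> x v" using right_exact[OF x v] .
    have nu: "\<nu> x (r v) w (A w) \<in> homset (C (x \<otimes> v)) (on_ob (\<Phi> x v) (on_ob (\<Phi> (r v) w) (A w)))
        (on_ob (\<Phi> (r (x \<otimes> v)) w) (A w))"
      using nu_closed[OF x r(1)[OF v] w object_component[OF M w]] r(2)[OF v] rr rx by simp
    note Fe = F.on_ar_closed[OF e[OF v]] and Fm = F.on_ar_closed[OF m[OF v]]
      and axv = structure_component[OF M x v]
    have "\<alpha> x v \<cdot>\<^bsub>C (x \<otimes> v)\<^esub> on_ar (\<Phi> x v) (m v) \<cdot>\<^bsub>C (x \<otimes> v)\<^esub> on_ar (\<Phi> x v) (e v) =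
        \<alpha> x v \<cdot>\<^bsub>C (x \<otimes> v)\<^esub> on_ar (\<Phi> x v) (\<alpha> (r v) w)"
      using Z.comp_assoc[OF Fe Fm axv] F.on_ar_comp[OF e[OF v] m[OF v]] me[OF v] by simp
    also have "\<dots> = \<alpha> (r (x \<otimes> v)) w \<cdot>\<^bsub>C (x \<otimes> v)\<^esub> \<nu> x (r v) w (A w)"
      using structure_assoc[OF M x r(1)[OF v] w] r(2)[OF v] rr rx by simp
    also have "\<dots> = m (x \<otimes> v) \<cdot>\<^bsub>C (x \<otimes> v)\<^esub> (e (x \<otimes> v) \<cdot>\<^bsub>C (x \<otimes> v)\<^esub> \<nu> x (r v) w (A w))"
      using me[OF xv] Z.comp_assoc[OF nu e[OF xv] m[OF xv]] by simp
    finally show ?thesis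
      using Z.epic_monic_lift[OF F.preserves_epic[OF abelian[OF v] component_preadditive[OF xv] epic[OF v]] Fe
          monic[OF xv] m[OF xv] Z.comp_closed[OF nu e[OF xv]] Z.comp_closed[OF Fm axv]] by blast
  qed
  then obtain \<beta> where f: "((restrict I (carrier W), \<beta>), (A, \<alpha>), restrict m (carrier W)) \<in> arrows"
    using subobject_of_stable_family[OF M m monic] by blast
  define N where "N = (restrict I (carrier W), \<beta>)"
  have "monic glued (N, (A, \<alpha>), restrict m (carrier W))"
    unfolding N_def using glued_monicI[OF f] monic by simp
  moreover have "dm glued (N, (A, \<alpha>), restrict m (carrier W)) = N"
    "cd glued (N, (A, \<alpha>), restrict m (carrier W)) = (A, \<alpha>)"
    by (simp_all add: glued_category_def)
  ultimately have "zero_object glued N \<or> iso_ar glued (N, (A, \<alpha>), restrict m (carrier W))"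
    using simple unfolding simple_object_def by metis
  moreover have "\<not> zero_object glued N"
  proof
    assume "zero_object glued N"
    then have zero: "zero_object (C w) (I w)"
      using glued_zero_object_iff[OF glued_arrowsD(1)[OF f]] w by (simp add: N_def)
    interpret preadditive_category "C w" using component_preadditive[OF w] .
    have Aw: "A w \<in> Ob (C w)" using object_component[OF M w] .
    have rw: "r w = \<one>" using w by (simp add: r_def)
    have "\<i>\<^bsub>C w\<^esub> (A w) = m w \<cdot>\<^bsub>C w\<^esub> e w"
      using me[OF w] structure_one[OF M w] rw by simp
    moreover have "e w \<in> homset (C w) (A w) (I w)"
      using e[OF w] one_on_ob[OF w Aw] rw by simp
    ultimately have "\<i>\<^bsub>C w\<^esub> (A w) = zero_ar (C w) (A w) (A w)"
      using zero_object_arrow_to[OF zero] comp_zero_right[OF m[OF w] Aw] by simp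
    then show False using nonzero Aw by (simp add: zero_object_iff)
  qed
  ultimately have iso: "iso_ar glued (N, (A, \<alpha>), restrict m (carrier W))" by blast
  have uw: "u \<otimes> w \<in> carrier W" and ru: "r (u \<otimes> w) = u"
    using u w by (simp_all add: r_def m_assoc)
  interpret category "C (u \<otimes> w)" using component_category[OF uw] .
  have "epic (C (u \<otimes> w)) (m (u \<otimes> w))"
    using iso_epic glued_iso_component[OF iso uw] uw by simp
  then show ?thesis
    using epic_comp[OF epic[OF uw] e[OF uw] _ m[OF uw]] me[OF uw] ru by simp
qed

text \<open>
For a point \<open>v = u s w\<close> beyond the wall with \<open>\<ell>(u s) = \<ell>(u) + 1\<close>, the functor \<open>\<Phi>\<^bsub>u s\<^esub>\<close> is
isomorphic to \<open>\<Phi>\<^sub>u \<Phi>\<^sub>s\<close>.  Hence the structure map from \<open>w\<close> to \<open>v\<close> factors through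
\<open>\<Phi>\<^sub>u\<close> of the component at \<open>s w\<close>, which is zero.  As this map is also an epimorphism, the
component at \<open>v\<close> vanishes.
\<close>

lemma simple_support_in_boundary_halfspace:
  assumes simple: "simple_object glued M" and s: "s \<in> S"
    and w: "w \<in> glued_support W C M" and sw: "s \<otimes> w \<notin> glued_support W C M"
  shows "glued_support W C M \<subseteq> ascent_set W S s #> w"
proof
  obtain A \<alpha> where M_eq: "M = (A, \<alpha>)" by force
  have M: "(A, \<alpha>) \<in> objects" using simple by (simp add: M_eq simple_object_def glued_category_def)
  have wW: "w \<in> carrier W" and sW: "s \<in> carrier W" and nonzero: "\<not> zero_object (C w) (A w)"
    using w s gen_closed by (auto simp: glued_support_def M_eq)
  have swW: "s \<otimes> w \<in> carrier W" and zero: "zero_object (C (s \<otimes> w)) (A (s \<otimes> w))"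
    using sw sW wW by (auto simp: glued_support_def M_eq)
  fix v assume v: "v \<in> glued_support W C M"
  then have vW: "v \<in> carrier W" by (simp add: glued_support_def)
  show "v \<in> ascent_set W S s #> w"
  proof (rule ccontr)
    assume "v \<notin> ascent_set W S s #> w"
    \<comment> \<open>Beyond the wall the last letter of a reduced word for \<open>v w\<inverse>\<close> can be chosen to be \<open>s\<close>.\<close>
    define u where "u = v \<otimes> inv w \<otimes> s"
    have u: "u \<in> carrier W" using vW wW sW by (simp add: u_def)
    have us: "u \<otimes> s = v \<otimes> inv w"
      using gen_cancel_right[OF s, of "v \<otimes> inv w"] vW wW by (simp add: u_def)
    then have usw: "u \<otimes> s \<otimes> w = v" using vW wW by (simp add: m_assoc)
    have usw': "u \<otimes> (s \<otimes> w) = v" using usw u sW wW by (simp add: m_assoc)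
    have "v \<otimes> inv w \<notin> ascent_set W S s"
      using \<open>v \<notin> ascent_set W S s #> w\<close> halfspace_iff wW vW by blast
    then have "len (u \<otimes> s) = len u + len s"
      using not_ascent_length[of s "v \<otimes> inv w"] s vW wW us by (simp add: u_def length_gen)
    then have "iso_ar (C v) (\<nu> u s w (A w))"
      using nu_iso[OF u sW wW object_component[OF M wW]] usw by simp
    then have nu_epic: "epic (C v) (\<nu> u s w (A w))"
      by (rule category.iso_epic[OF component_category[OF vW]])
    interpret V: preadditive_category "C v" using component_preadditive[OF vW] .
    interpret F: right_exact_functor "C (s \<otimes> w)" "C v" "\<Phi> u (s \<otimes> w)"
      using right_exact[OF u swW] usw' by simp
    note nu = nu_closed[OF u sW wW object_component[OF M wW], unfolded usw]
    have Phi_sw: "on_ob (\<Phi> s w) (A w) \<in> Ob (C (s \<otimes> w))"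
      using cat_functor.on_ob_closed[OF gluing_functor[OF sW wW] object_component[OF M wW]] .
    define X where "X = on_ob (\<Phi> u (s \<otimes> w)) (on_ob (\<Phi> s w) (A w))"
    have X: "X \<in> Ob (C v)" unfolding X_def using F.on_ob_closed[OF Phi_sw] .
    have "\<alpha> s w = zero_ar (C (s \<otimes> w)) (on_ob (\<Phi> s w) (A w)) (A (s \<otimes> w))"
      using preadditive_category.zero_object_arrow_to[OF component_preadditive[OF swW] zero]
        structure_component[OF M sW wW] by blast
    then have "on_ar (\<Phi> u (s \<otimes> w)) (\<alpha> s w) = zero_ar (C v) X (on_ob (\<Phi> u (s \<otimes> w)) (A (s \<otimes> w)))"
      using F.preserves_zero_arrow[OF component_preadditive[OF swW] component_preadditive[OF vW] Phi_sw
          object_component[OF M swW]] by (simp add: X_def)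
    then have "\<alpha> u (s \<otimes> w) \<cdot>\<^bsub>C v\<^esub> on_ar (\<Phi> u (s \<otimes> w)) (\<alpha> s w) = zero_ar (C v) X (A v)"
      using V.comp_zero_right[OF structure_component[OF M u swW, unfolded usw'] X] by simp
    then have "\<alpha> (u \<otimes> s) w \<cdot>\<^bsub>C v\<^esub> \<nu> u s w (A w) = zero_ar (C v) X (A v)"
      using structure_assoc[OF M u sW wW] usw by simp
    moreover have "epic (C v) (\<alpha> (u \<otimes> s) w)"
      using simple_structure_epic[OF simple[unfolded M_eq] _ wW nonzero, of "u \<otimes> s"] u sW usw by simp
    moreover have "\<alpha> (u \<otimes> s) w \<in> homset (C v) (on_ob (\<Phi> (u \<otimes> s) w) (A w)) (A v)"
      using structure_component[OF M _ wW, of "u \<otimes> s"] u sW usw by simp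
    ultimately have "epic (C v) (zero_ar (C v) X (A v))"
      using V.epic_comp[OF nu_epic nu] by metis
    then have "zero_object (C v) (A v)"
      using V.epic_zero_arrow X object_component[OF M vW] by blast
    then show False using v by (simp add: glued_support_def M_eq)
  qed
qed

lemma simple_support_nonempty:
  assumes "simple_object glued M"
  shows "glued_support W C M \<noteq> {}"
  using assms glued_zero_object_iff[of M]
  by (auto simp: simple_object_def glued_support_def glued_category_def)

end

theorem theorem7p10p2:
  fixes W :: "('w, 'b) monoid_scheme"
    and s :: "nat \<Rightarrow> 'w" and n :: nat
    and C :: "'w \<Rightarrow> ('o, 'm, 'z) preadditive_category_scheme"
    and \<Phi> :: "'w \<Rightarrow> 'w \<Rightarrow> ('o, 'm, 'o, 'm) cat_functor"
    and \<nu> :: "'w \<Rightarrow> 'w \<Rightarrow> 'w \<Rightarrow> 'o \<Rightarrow> 'm"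
    and M :: "('w, 'o, 'm) glued_ob"
  assumes "coxeter_system W S"
    and "finite (carrier W)"
    and "bij_betw s {1..n} S"
    and "gluing_data W S C \<Phi> \<nu>"
    and "simple_object (glued_category W C \<Phi> \<nu>) M"
  shows "(glued_support W C M = carrier W \<or>
      (\<exists>F \<subseteq> {1..n} \<times> carrier W. F \<noteq> {} \<and>
        glued_support W C M = (\<Inter>(i, x) \<in> F. ascent_set W S (s i) #>\<^bsub>W\<^esub> x))) \<and>
    (glued_support W C M \<noteq> carrier W \<longrightarrow>
      geodesically_convex (coxeter_graph W S) (glued_support W C M))"
proof -
  interpret gluing_data W S C \<Phi> \<nu> by fact
  define P where "P = glued_support W C M"
  define F where "F = {(i, x). i \<in> {1..n} \<and> x \<in> carrier W \<and> P \<subseteq> ascent_set W S (s i) #>\<^bsub>W\<^esub> x}"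
  have P_sub: "P \<subseteq> carrier W" by (auto simp: P_def glued_support_def)
  have s_image: "S = s ` {1..n}" using assms(3) by (simp add: bij_betw_def)
  have separate: "\<exists>(i, x) \<in> F. y \<notin> ascent_set W S (s i) #>\<^bsub>W\<^esub> x" if "y \<in> carrier W" "y \<notin> P" for y
    using halfspace_separates_from_boundary_closed_set[OF P_sub _ _ that]
      simple_support_nonempty[OF assms(5)] simple_support_in_boundary_halfspace[OF assms(5)]
    by (fastforce simp: P_def[symmetric] F_def s_image)
  have main: "F \<noteq> {} \<and> P = (\<Inter>(i, x) \<in> F. ascent_set W S (s i) #>\<^bsub>W\<^esub> x)" if "P \<noteq> carrier W"
  proof
    obtain y where "y \<in> carrier W" "y \<notin> P" using \<open>P \<noteq> carrier W\<close> P_sub by blast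
    then show "F \<noteq> {}" using separate by blast
    then have "(\<Inter>(i, x) \<in> F. ascent_set W S (s i) #>\<^bsub>W\<^esub> x) \<subseteq> carrier W"
      using halfspace_iff by (fastforce simp: F_def)
    moreover have "P \<subseteq> (\<Inter>(i, x) \<in> F. ascent_set W S (s i) #>\<^bsub>W\<^esub> x)" by (auto simp: F_def)
    moreover have "y \<in> P" if "y \<in> carrier W" "y \<in> (\<Inter>(i, x) \<in> F. ascent_set W S (s i) #>\<^bsub>W\<^esub> x)" for y
      using separate[of y] that by fastforce
    ultimately show "P = (\<Inter>(i, x) \<in> F. ascent_set W S (s i) #>\<^bsub>W\<^esub> x)"
      by (intro equalityI subsetI) auto
  qed
  have "geodesically_convex (coxeter_graph W S) P" if "P \<noteq> carrier W"
    unfolding geodesically_convex_def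
  proof (intro conjI allI impI)
    show "P \<subseteq> verts (coxeter_graph W S)" using P_sub by (simp add: coxeter_graph_def)
    fix p assume p: "geodesic (coxeter_graph W S) p \<and> hd p \<in> P \<and> last p \<in> P"
    have "set p \<subseteq> ascent_set W S (s i) #>\<^bsub>W\<^esub> x" if "(i, x) \<in> F" for i x
    proof -
      have "s i \<in> S" "x \<in> carrier W" "P \<subseteq> ascent_set W S (s i) #>\<^bsub>W\<^esub> x"
        using that by (auto simp: F_def s_image)
      then show ?thesis
        using halfspace_convex p unfolding geodesically_convex_def by blast
    qed
    then show "set p \<subseteq> P" using main[OF that] by blast
  qed
  moreover have "F \<subseteq> {1..n} \<times> carrier W" by (auto simp: F_def)
  ultimately show ?thesis using main unfolding P_def[symmetric] by blast
qed

end
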